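(* For a positive integer $t$, let $f(n;t)$ denote the maximum number of edges in a linear $3$-uniform hypergraph on $n$ vertices which contains no $2$-regular subhypergraph with at most $t$ edges. For any integer $\ell\geq 2$ there exists a constant $c=c(\ell)$ such that for all $n$, $$f(n;4\ell)\leq c\, n^{3/2+1/\ell}.$$
   Context: A hypergraph is linear if any two distinct edges intersect in at most one vertex. A non-empty hypergraph is $2$-regular if every vertex in it has degree $2$; a subhypergraph is given by a subset of the edges together with the vertices they cover. *)

theory Defs
  imports Complex_Main
begin

text \<open>A hypergraph is a finite vertex set \<open>V\<close> with a set \<open>E\<close> of subsets of \<open>V\<close>; there are no
  multiple edges, and isolated vertices are allowed.\<close>

definition hypergraph :: "'a set \<Rightarrow> 'a set set \<Rightarrow> bool" where
  "hypergraph V E \<longleftrightarrow> finite V \<and> (\<forall>e\<in>E. e \<subseteq> V)"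

definition uniform :: "nat \<Rightarrow> 'a set set \<Rightarrow> bool" where
  "uniform r E \<longleftrightarrow> (\<forall>e\<in>E. card e = r)"

definition linear_hypergraph :: "'a set set \<Rightarrow> bool" where
  "linear_hypergraph E \<longleftrightarrow> (\<forall>e\<in>E. \<forall>e'\<in>E. e \<noteq> e' \<longrightarrow> card (e \<inter> e') \<le> 1)"

definition degree :: "'a set set \<Rightarrow> 'a \<Rightarrow> nat" where
  "degree E v = card {e\<in>E. v \<in> e}"

definition two_regular :: "'a set \<Rightarrow> 'a set set \<Rightarrow> bool" where
  "two_regular V E \<longleftrightarrow> E \<noteq> {} \<and> (\<forall>v\<in>V. degree E v = 2)"

text \<open>A subhypergraph is determined by its edge set \<open>F \<subseteq> E\<close>; its vertex set is \<open>\<Union>F\<close>.\<close>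

definition has_two_regular_sub :: "'a set set \<Rightarrow> nat \<Rightarrow> bool" where
  "has_two_regular_sub E t \<longleftrightarrow> (\<exists>F. F \<subseteq> E \<and> card F \<le> t \<and> two_regular (\<Union>F) F)"

definition admissible :: "'a set \<Rightarrow> nat \<Rightarrow> 'a set set \<Rightarrow> bool" where
  "admissible V t E \<longleftrightarrow> hypergraph V E \<and> uniform 3 E \<and> linear_hypergraph E \<and>
     \<not> has_two_regular_sub E t"

text \<open>The extremal number. The vertex set is fixed to be \<open>{..<n}\<close>. The maximum is over a
  finite non-empty set, by the lemmas below.\<close>

definition f_ext :: "nat \<Rightarrow> nat \<Rightarrow> nat" where
  "f_ext n t = Max {card E | E. admissible {..<n} t E}"

lemma finite_admissible_cards:
  assumes "finite V"
  shows "finite {card E | E. admissible V t E}"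
proof -
  have "{card E | E. admissible V t E} \<subseteq> card ` Pow (Pow V)"
    by (auto simp: admissible_def hypergraph_def)
  then show ?thesis
    using assms by (meson finite_Pow_iff finite_imageI finite_subset)
qed

lemma admissible_empty: "finite V \<Longrightarrow> admissible V t {}"
  by (simp add: admissible_def hypergraph_def uniform_def linear_hypergraph_def
      has_two_regular_sub_def two_regular_def)

lemma admissible_card_le_f_ext: "admissible {..<n} t E \<Longrightarrow> card E \<le> f_ext n t"
  unfolding f_ext_def by (rule Max_ge[OF finite_admissible_cards]) auto

lemma f_ext_attained: "\<exists>E. admissible {..<n} t E \<and> card E = f_ext n t"
proof -
  have "f_ext n t \<in> {card E | E. admissible {..<n} t E}"
    unfolding f_ext_def
    by (rule Max_in[OF finite_admissible_cards]) (use admissible_empty[of "{..<n}" t] in auto)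
  then show ?thesis by auto
qed

end

theory Submission
  imports Defs "HOL-Analysis.Convex"
begin

text \<open>Join the ordered pairs \<open>(a, b)\<close> and \<open>(a', b')\<close> of vertices whenever \<open>{v, a, a'}\<close> and
  \<open>{v, b, b'}\<close> are distinct edges for some \<open>v\<close>, and give this step the three labels \<open>a'\<close>, \<open>b'\<close>,
  \<open>v\<close>. A closed walk of length \<open>2l\<close> in this graph whose steps have pairwise disjoint labels is a
  \<open>2\<close>-regular subhypergraph with \<open>4l\<close> edges. If every closed walk had a label conflict, then
  \<open>tr A ^ 2l\<close>, for the normalized adjacency matrix \<open>A\<close>, would be at most a sum of boundedly many terms
  \<open>\<Sum>c. tr (B c * A ^ a * C c * A ^ b)\<close> with \<open>a + b = 2l - 2\<close>, where \<open>B c\<close> and \<open>C c\<close> keep only the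
  steps labelled \<open>c\<close>. Since a vertex and a label determine the step, the Cauchy-Schwarz inequality
  bounds each term by the geometric mean of \<open>tr A ^ 2l\<close> and \<open>tr A ^ (2l - 2) / \<delta>\<close>, where \<open>\<delta>\<close> is the
  average degree. Log-convexity of the even traces and \<open>tr A ^ 2l \<ge> 4 ^ (-l)\<close> turn this into
  \<open>\<delta> ^ l \<le> const * n\<^sup>2\<close>, while \<open>m > n\<close> edges force \<open>\<delta> \<ge> m\<^sup>2 / n\<^sup>3\<close>.\<close>

section \<open>Matrices indexed by a finite set\<close>

definition mat_mul :: "'a set \<Rightarrow> ('a \<Rightarrow> 'a \<Rightarrow> real) \<Rightarrow> ('a \<Rightarrow> 'a \<Rightarrow> real) \<Rightarrow> 'a \<Rightarrow> 'a \<Rightarrow> real" where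
  "mat_mul S M N = (\<lambda>x y. \<Sum>z\<in>S. M x z * N z y)"

definition mat_one :: "'a set \<Rightarrow> 'a \<Rightarrow> 'a \<Rightarrow> real" where
  "mat_one S = (\<lambda>x y. if x = y \<and> x \<in> S then 1 else 0)"

definition mat_trace :: "'a set \<Rightarrow> ('a \<Rightarrow> 'a \<Rightarrow> real) \<Rightarrow> real" where
  "mat_trace S M = (\<Sum>x\<in>S. M x x)"

text \<open>The square of the Frobenius norm. On powers of a symmetric matrix it is an even moment
  of the spectrum (\<open>frob_pow\<close>), so all spectral estimates can be phrased with
  it.\<close>

definition frob :: "'a set \<Rightarrow> ('a \<Rightarrow> 'a \<Rightarrow> real) \<Rightarrow> real" where
  "frob S M = (\<Sum>x\<in>S. \<Sum>y\<in>S. (M x y)\<^sup>2)"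

text \<open>Matrices are total functions on the index type, so \<open>mat_one S\<close> acts as a
  unit only on those that vanish outside \<open>S\<close>.\<close>

definition supported :: "'a set \<Rightarrow> ('a \<Rightarrow> 'a \<Rightarrow> real) \<Rightarrow> bool" where
  "supported S M \<longleftrightarrow> (\<forall>x y. M x y \<noteq> 0 \<longrightarrow> x \<in> S \<and> y \<in> S)"

text \<open>The factors may vary with the position because a label will be imposed on two chosen
  steps of a walk. Constant sequences give the powers.\<close>

primrec mat_chain :: "'a set \<Rightarrow> (nat \<Rightarrow> 'a \<Rightarrow> 'a \<Rightarrow> real) \<Rightarrow> nat \<Rightarrow> 'a \<Rightarrow> 'a \<Rightarrow> real" where
  "mat_chain S M 0 = mat_one S"
| "mat_chain S M (Suc m) = mat_mul S (mat_chain S M m) (M m)"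

abbreviation mat_pow :: "'a set \<Rightarrow> ('a \<Rightarrow> 'a \<Rightarrow> real) \<Rightarrow> nat \<Rightarrow> 'a \<Rightarrow> 'a \<Rightarrow> real" where
  "mat_pow S A m \<equiv> mat_chain S (\<lambda>_. A) m"

lemma mat_mul_assoc: "mat_mul S (mat_mul S L M) N = mat_mul S L (mat_mul S M N)"
proof (intro ext)
  fix x y
  have "mat_mul S (mat_mul S L M) N x y = (\<Sum>z\<in>S. \<Sum>w\<in>S. L x w * M w z * N z y)"
    by (simp add: mat_mul_def sum_distrib_right)
  also have "\<dots> = (\<Sum>w\<in>S. \<Sum>z\<in>S. L x w * M w z * N z y)"
    by (rule sum.swap)
  also have "\<dots> = mat_mul S L (mat_mul S M N) x y"
    by (simp add: mat_mul_def sum_distrib_left mult.assoc)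
  finally show "mat_mul S (mat_mul S L M) N x y = mat_mul S L (mat_mul S M N) x y" .
qed

lemma mat_mul_one_right:
  assumes "finite S" "supported S M"
  shows "mat_mul S M (mat_one S) = M"
proof (intro ext)
  fix x y
  have "mat_mul S M (mat_one S) x y = (\<Sum>z\<in>S. if z = y then M x z else 0)"
    unfolding mat_mul_def mat_one_def by (rule sum.cong) auto
  also have "\<dots> = M x y"
    using assms by (auto simp: supported_def)
  finally show "mat_mul S M (mat_one S) x y = M x y" .
qed

lemma mat_mul_one_left:
  assumes "finite S" "supported S M"
  shows "mat_mul S (mat_one S) M = M"
proof (intro ext)
  fix x y
  have "mat_mul S (mat_one S) M x y = (\<Sum>z\<in>S. if x = z then M z y else 0)"
    unfolding mat_mul_def mat_one_def by (rule sum.cong) auto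
  also have "\<dots> = M x y"
    using assms by (auto simp: supported_def)
  finally show "mat_mul S (mat_one S) M x y = M x y" .
qed

lemma supported_one: "supported S (mat_one S)"
  by (simp add: supported_def mat_one_def)

lemma supported_mul:
  assumes "supported S M" "supported S N"
  shows "supported S (mat_mul S M N)"
  unfolding supported_def
proof (intro allI impI)
  fix x y
  assume "mat_mul S M N x y \<noteq> 0"
  then obtain z where "z \<in> S" "M x z * N z y \<noteq> 0"
    unfolding mat_mul_def by (meson sum.not_neutral_contains_not_neutral)
  then show "x \<in> S \<and> y \<in> S"
    using assms by (auto simp: supported_def)
qed

lemma supported_chain:
  assumes "\<And>i. supported S (M i)"
  shows "supported S (mat_chain S M m)"
  by (induction m) (auto intro: supported_one supported_mul assms)

lemma mat_chain_add:
  assumes "finite S" "\<And>i. supported S (M i)"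
  shows "mat_chain S M (m + n) = mat_mul S (mat_chain S M m) (mat_chain S (\<lambda>i. M (m + i)) n)"
  by (induction n) (simp_all add: mat_mul_one_right assms supported_chain mat_mul_assoc)

lemma mat_chain_cong:
  assumes "\<And>i. i < m \<Longrightarrow> M i = N i"
  shows "mat_chain S M m = mat_chain S N m"
  using assms by (induction m) auto

lemma mat_pow_one:
  assumes "finite S" "supported S A"
  shows "mat_pow S A (Suc 0) = A"
  using assms by (simp add: mat_mul_one_left)

lemma mat_pow_add:
  assumes "finite S" "supported S A"
  shows "mat_pow S A (m + n) = mat_mul S (mat_pow S A m) (mat_pow S A n)"
  using mat_chain_add[of S "\<lambda>_. A"] assms by simp

lemma mat_pow_nonneg:
  assumes "\<And>x y. A x y \<ge> 0"
  shows "mat_pow S A m x y \<ge> 0"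
  using assms by (induction m arbitrary: x y) (auto simp: mat_one_def mat_mul_def intro!: sum_nonneg)

lemma mat_pow_sym:
  assumes "finite S" "supported S A" "\<And>x y. A x y = A y x"
  shows "mat_pow S A m x y = mat_pow S A m y x"
proof (induction m arbitrary: x y)
  case 0
  then show ?case by (auto simp: mat_one_def)
next
  case (Suc m)
  have "mat_pow S A (Suc m) x y = (\<Sum>z\<in>S. mat_pow S A m x z * A z y)"
    by (simp add: mat_mul_def)
  also have "\<dots> = (\<Sum>z\<in>S. A y z * mat_pow S A m z x)"
    using Suc assms(3) by (intro sum.cong) (simp_all add: mult.commute)
  also have "\<dots> = mat_mul S (mat_pow S A (Suc 0)) (mat_pow S A m) y x"
    by (simp only: mat_pow_one[OF assms(1,2)]) (simp add: mat_mul_def)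
  also have "\<dots> = mat_pow S A (Suc m) y x"
    using mat_pow_add[OF assms(1,2), of "Suc 0" m] by simp
  finally show ?case .
qed

section \<open>Traces, Frobenius norms and log-convex sequences\<close>

lemma mat_trace_cyclic: "mat_trace S (mat_mul S M N) = mat_trace S (mat_mul S N M)"
  unfolding mat_trace_def mat_mul_def by (subst sum.swap) (simp add: mult.commute)

lemma frob_nonneg: "frob S M \<ge> 0"
  by (simp add: frob_def sum_nonneg)

lemma frob_pow:
  assumes "finite S" "supported S A" "\<And>x y. A x y = A y x"
  shows "frob S (mat_pow S A m) = mat_trace S (mat_pow S A (m + m))"
proof -
  have "mat_trace S (mat_pow S A (m + m)) =
      (\<Sum>x\<in>S. \<Sum>y\<in>S. mat_pow S A m x y * mat_pow S A m y x)"
    by (simp add: mat_trace_def mat_pow_add[OF assms(1,2)] mat_mul_def)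
  also have "\<dots> = frob S (mat_pow S A m)"
    unfolding frob_def power2_eq_square
    by (intro sum.cong refl) (metis mat_pow_sym[OF assms])
  finally show ?thesis by simp
qed

text \<open>The trace of a product is the entrywise inner product of one factor with the transpose
  of the other, and transposing preserves \<open>frob\<close>. A single Cauchy-Schwarz inequality
  over \<open>C \<times> S \<times> S\<close> treats all labels at once.\<close>

lemma sum_trace_Cauchy_Schwarz:
  assumes "finite S" "finite C"
  shows "(\<Sum>c\<in>C. mat_trace S (mat_mul S (P c) (Q c)))\<^sup>2
    \<le> (\<Sum>c\<in>C. frob S (P c)) * (\<Sum>c\<in>C. frob S (Q c))"
proof -
  let ?I = "C \<times> S \<times> S"
  have "(\<Sum>c\<in>C. mat_trace S (mat_mul S (P c) (Q c)))
      = (\<Sum>(c, x, y)\<in>?I. P c x y * Q c y x)"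
    by (simp add: mat_trace_def mat_mul_def sum.cartesian_product)
  moreover have "(\<Sum>c\<in>C. frob S (P c)) = (\<Sum>(c, x, y)\<in>?I. (P c x y)\<^sup>2)"
    by (simp add: frob_def sum.cartesian_product)
  moreover have "(\<Sum>c\<in>C. frob S (Q c)) = (\<Sum>c\<in>C. \<Sum>x\<in>S. \<Sum>y\<in>S. (Q c y x)\<^sup>2)"
    unfolding frob_def by (intro sum.cong refl sum.swap)
  then have "(\<Sum>c\<in>C. frob S (Q c)) = (\<Sum>(c, x, y)\<in>?I. (Q c y x)\<^sup>2)"
    by (simp add: sum.cartesian_product)
  ultimately show ?thesis
    using Cauchy_Schwarz_ineq_sum[of "\<lambda>(c, x, y). P c x y" "\<lambda>(c, x, y). Q c y x" ?I]
    by (simp add: case_prod_unfold)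
qed

text \<open>Splitting the exponent \<open>2m + 2\<close> of the trace as \<open>m + (m + 2)\<close>
  instead of evenly makes Cauchy-Schwarz compare neighbouring even moments.\<close>

lemma frob_pow_log_convex:
  assumes "finite S" "supported S A" "\<And>x y. A x y = A y x"
  shows "(frob S (mat_pow S A (Suc m)))\<^sup>2
    \<le> frob S (mat_pow S A m) * frob S (mat_pow S A (Suc (Suc m)))"
proof -
  have "frob S (mat_pow S A (Suc m)) = mat_trace S (mat_pow S A (m + Suc (Suc m)))"
    unfolding frob_pow[OF assms] by simp
  also have "\<dots> = mat_trace S (mat_mul S (mat_pow S A m) (mat_pow S A (Suc (Suc m))))"
    by (simp only: mat_pow_add[OF assms(1,2), of m "Suc (Suc m)"])
  finally show ?thesis
    using sum_trace_Cauchy_Schwarz[OF assms(1), of "{()}" "\<lambda>_. mat_pow S A m"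
        "\<lambda>_. mat_pow S A (Suc (Suc m))"] by simp
qed

text \<open>Ratios of consecutive terms are nondecreasing, so a lower bound on the first ratio
  persists. Positivity is carried through the induction to allow cancellation.\<close>

lemma log_convex_growth:
  fixes s :: "nat \<Rightarrow> real"
  assumes "\<And>m. (s (Suc m))\<^sup>2 \<le> s m * s (Suc (Suc m))" "s 0 > 0" "r > 0" "s 1 \<ge> r * s 0"
  shows "s m \<ge> r ^ m * s 0"
proof -
  have "s m > 0 \<and> s (Suc m) \<ge> r * s m" for m
  proof (induction m)
    case 0
    then show ?case using assms by simp
  next
    case (Suc m)
    have pos: "s (Suc m) > 0"
      using Suc assms(3) by (meson mult_pos_pos order_less_le_trans)
    have "r * s m * s (Suc m) \<le> s (Suc m) * s (Suc m)"
      using Suc pos by (intro mult_right_mono) auto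
    also have "\<dots> \<le> s m * s (Suc (Suc m))"
      using assms(1)[of m] by (simp add: power2_eq_square)
    finally have "s m * (r * s (Suc m)) \<le> s m * s (Suc (Suc m))"
      by (simp add: algebra_simps)
    then show ?case
      using Suc pos by auto
  qed
  then have step: "s (Suc m) \<ge> r * s m" for m by blast
  show ?thesis
  proof (induction m)
    case (Suc m)
    then have "r * (r ^ m * s 0) \<le> r * s m"
      using assms(3) by (intro mult_left_mono) auto
    then show ?case using step[of m] by (simp add: mult.assoc)
  qed simp
qed

text \<open>Here the monotone ratios are read downwards: an upper bound on the last ratio holds for
  all earlier ones, and multiplying them reaches \<open>s 0\<close>. A vanishing term satisfies its
  bound trivially.\<close>

lemma log_convex_decay:
  fixes s :: "nat \<Rightarrow> real"
  assumes "\<And>m. (s (Suc m))\<^sup>2 \<le> s m * s (Suc (Suc m))" "\<And>m. s m \<ge> 0" "r \<ge> 0"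
    and "s (Suc m) \<le> r * s m"
  shows "s (Suc m) \<le> r ^ Suc m * s 0"
  using assms(4)
proof (induction m)
  case (Suc m)
  have *: "s (Suc m) \<le> r * s m"
  proof (cases "s (Suc m) = 0")
    case False
    then have pos: "s (Suc m) > 0" using assms(2)[of "Suc m"] by linarith
    have "s (Suc m) * s (Suc m) \<le> s m * s (Suc (Suc m))"
      using assms(1)[of m] by (simp add: power2_eq_square)
    also have "\<dots> \<le> s m * (r * s (Suc m))"
      using Suc.prems assms(2) by (intro mult_left_mono)
    finally have "s (Suc m) * s (Suc m) \<le> (r * s m) * s (Suc m)"
      by (simp add: algebra_simps)
    then show ?thesis using pos by auto
  qed (use assms(2,3) in auto)
  have "s (Suc (Suc m)) \<le> r * s (Suc m)" by (rule Suc.prems)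
  also have "\<dots> \<le> r * (r ^ Suc m * s 0)"
    using Suc.IH[OF *] assms(3) by (rule mult_left_mono)
  finally show ?case by simp
qed simp

section \<open>Matrix products as weighted sums over walks\<close>

lemma mat_chain_walks:
  assumes "finite S" "x \<in> S" "y \<in> S"
  shows "mat_chain S M m x y =
    (\<Sum>f\<in>{f \<in> {..m} \<rightarrow>\<^sub>E S. f 0 = x \<and> f m = y}. \<Prod>i<m. M i (f i) (f (Suc i)))"
  using assms(3)
proof (induction m arbitrary: y)
  case 0
  have eq: "{f \<in> {..0::nat} \<rightarrow>\<^sub>E S. f 0 = x \<and> f 0 = y}
      = (if x = y then {(\<lambda>i\<in>{..0}. x)} else {})"
    using assms(2) by (auto simp: PiE_iff extensional_def restrict_def fun_eq_iff)
  show ?case unfolding eq using assms(2) by (simp add: mat_one_def)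
next
  case (Suc m)
  let ?W = "\<lambda>m y. {f \<in> {..m} \<rightarrow>\<^sub>E S. f 0 = x \<and> f m = y}"
  have fin: "finite (?W m z)" for z
    using assms(1) by (intro finite_subset[OF _ finite_PiE[of "{..m}" "\<lambda>_. S"]]) auto
  have "mat_chain S M (Suc m) x y =
      (\<Sum>z\<in>S. \<Sum>f\<in>?W m z. (\<Prod>i<m. M i (f i) (f (Suc i))) * M m z y)"
    by (simp add: mat_mul_def Suc.IH sum_distrib_right)
  also have "\<dots> = (\<Sum>(z, f)\<in>Sigma S (?W m). (\<Prod>i<m. M i (f i) (f (Suc i))) * M m z y)"
    using assms(1) fin by (subst sum.Sigma) auto
  also have "\<dots> = (\<Sum>f\<in>?W (Suc m) y. \<Prod>i<Suc m. M i (f i) (f (Suc i)))"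
  \<comment> \<open>A walk of length \<open>Suc m\<close> ending in \<open>y\<close> corresponds to
    its next-to-last vertex and its initial segment. Since walks are extensional on
    \<open>{..m}\<close>, restricting and appending \<open>y\<close> are mutually inverse.\<close>
  proof (rule sum.reindex_bij_witness
      [of _ "\<lambda>f. (f m, restrict f {..m})" "\<lambda>(z, f). f(Suc m := y)"])
    fix g assume "g \<in> Sigma S (?W m)"
    then obtain z f where g: "g = (z, f)" and z: "z \<in> S" and f: "f \<in> ?W m z" by auto
    have "restrict (f(Suc m := y)) {..m} = f"
      using f by (auto simp: PiE_iff extensional_def restrict_def fun_eq_iff)
    then show "(\<lambda>f. (f m, restrict f {..m})) ((\<lambda>(z, f). f(Suc m := y)) g) = g"
      using f g by auto
    show "(\<lambda>(z, f). f(Suc m := y)) g \<in> ?W (Suc m) y"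
      using f g Suc.prems by (auto simp: PiE_iff extensional_def le_Suc_eq)
    have "(\<Prod>i<m. M i ((f(Suc m := y)) i) ((f(Suc m := y)) (Suc i))) =
        (\<Prod>i<m. M i (f i) (f (Suc i)))"
      by (intro prod.cong) auto
    then show "(\<Prod>i<Suc m. M i (((\<lambda>(z, f). f(Suc m := y)) g) i)
          (((\<lambda>(z, f). f(Suc m := y)) g) (Suc i))) =
        (case g of (z, f) \<Rightarrow> (\<Prod>i<m. M i (f i) (f (Suc i))) * M m z y)"
      using f g by simp
  next
    fix f assume f: "f \<in> ?W (Suc m) y"
    show "(\<lambda>(z, f). f(Suc m := y)) ((\<lambda>f. (f m, restrict f {..m})) f) = f"
      using f by (auto simp: PiE_iff extensional_def restrict_def fun_eq_iff le_Suc_eq)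
    show "(\<lambda>f. (f m, restrict f {..m})) f \<in> Sigma S (?W m)"
      using f by (auto simp: PiE_iff)
  qed
  finally show ?case .
qed

lemma mat_trace_chain_walks:
  assumes "finite S"
  shows "mat_trace S (mat_chain S M m) =
    (\<Sum>f\<in>{f \<in> {..m} \<rightarrow>\<^sub>E S. f 0 = f m}. \<Prod>i<m. M i (f i) (f (Suc i)))"
proof -
  let ?W = "\<lambda>x. {f \<in> {..m} \<rightarrow>\<^sub>E S. f 0 = x \<and> f m = x}"
  have fin: "finite (?W x)" for x
    using assms(1) by (intro finite_subset[OF _ finite_PiE[of "{..m}" "\<lambda>_. S"]]) auto
  have "mat_trace S (mat_chain S M m) = (\<Sum>x\<in>S. \<Sum>f\<in>?W x. \<Prod>i<m. M i (f i) (f (Suc i)))"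
    by (simp add: mat_trace_def mat_chain_walks assms)
  also have "\<dots> = (\<Sum>f\<in>(\<Union>x\<in>S. ?W x). \<Prod>i<m. M i (f i) (f (Suc i)))"
    using assms fin by (intro sum.UNION_disjoint[symmetric]) auto
  also have "(\<Union>x\<in>S. ?W x) = {f \<in> {..m} \<rightarrow>\<^sub>E S. f 0 = f m}"
    by (auto simp: PiE_iff)
  finally show ?thesis .
qed

section \<open>Closed walks without label conflicts\<close>

text \<open>At any entry exactly one label survives, so for a fixed labelling these parts have
  disjoint supports and decompose \<open>A\<close>.\<close>

definition label_part :: "('a \<Rightarrow> 'a \<Rightarrow> 'c) \<Rightarrow> ('a \<Rightarrow> 'a \<Rightarrow> real) \<Rightarrow> 'c \<Rightarrow> 'a \<Rightarrow> 'a \<Rightarrow> real" where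
  "label_part \<phi> A c = (\<lambda>x y. if \<phi> x y = c then A x y else 0)"

lemma supported_label_part: "supported S A \<Longrightarrow> supported S (label_part \<phi> A c)"
  by (auto simp: supported_def label_part_def)

lemma sum_power2_le_power2_sum:
  fixes g :: "'c \<Rightarrow> real"
  assumes "finite C" "\<And>c. c \<in> C \<Longrightarrow> g c \<ge> 0"
  shows "(\<Sum>c\<in>C. (g c)\<^sup>2) \<le> (\<Sum>c\<in>C. g c)\<^sup>2"
  using assms
proof (induction C rule: finite_induct)
  case (insert c C)
  then have "0 \<le> g c * (\<Sum>c\<in>C. g c)"
    by (intro mult_nonneg_nonneg sum_nonneg) auto
  then show ?case
    using insert by (simp add: power2_sum)
qed simp

lemma sum_label_part_le:
  assumes "finite C" "A x y \<ge> 0"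
  shows "(\<Sum>c\<in>C. label_part \<phi> A c x y) \<le> A x y"
  using assms by (simp add: label_part_def)

text \<open>Entries are nonnegative, so the sum over \<open>c\<close> of the squares is at most the
  square of the sum. By linearity that sum is dominated entrywise by the power with \<open>A\<close>
  itself in the middle.\<close>

lemma sum_frob_label_part_le:
  assumes "finite S" "finite C" "supported S A" "\<And>x y. A x y \<ge> 0"
  shows "(\<Sum>c\<in>C. frob S (mat_mul S (mat_pow S A p) (mat_mul S (label_part \<phi> A c) (mat_pow S A q))))
    \<le> frob S (mat_pow S A (p + Suc q))"
proof -
  let ?P = "mat_pow S A p" and ?Q = "mat_pow S A q"
  let ?B = "\<lambda>c. mat_mul S ?P (mat_mul S (label_part \<phi> A c) ?Q)"
  have nn: "?B c x y \<ge> 0" for c x y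
    using assms(4) mat_pow_nonneg[OF assms(4), where S=S]
    by (auto simp: mat_mul_def label_part_def intro!: sum_nonneg mult_nonneg_nonneg)
  have pow: "mat_pow S A (p + Suc q) = mat_mul S ?P (mat_mul S A ?Q)"
    using mat_pow_add[OF assms(1,3), of "Suc 0" q] mat_pow_one[OF assms(1,3)]
    by (simp only: mat_pow_add[OF assms(1,3), of p "Suc q"]) simp
  have le: "(\<Sum>c\<in>C. ?B c x y) \<le> mat_pow S A (p + Suc q) x y" for x y
  proof -
    have "(\<Sum>c\<in>C. ?B c x y) =
        (\<Sum>z\<in>S. \<Sum>w\<in>S. ?P x z * ((\<Sum>c\<in>C. label_part \<phi> A c z w) * ?Q w y))"
      unfolding mat_mul_def sum_distrib_left sum_distrib_right
      by (subst sum.swap, rule sum.cong[OF refl], rule sum.swap)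
    also have "\<dots> \<le> (\<Sum>z\<in>S. \<Sum>w\<in>S. ?P x z * (A z w * ?Q w y))"
      using assms mat_pow_nonneg[OF assms(4), where S=S]
      by (intro sum_mono mult_left_mono mult_right_mono sum_label_part_le) auto
    also have "\<dots> = mat_pow S A (p + Suc q) x y"
      unfolding pow by (simp add: mat_mul_def sum_distrib_left)
    finally show ?thesis .
  qed
  have "(\<Sum>c\<in>C. frob S (?B c)) = (\<Sum>x\<in>S. \<Sum>y\<in>S. \<Sum>c\<in>C. (?B c x y)\<^sup>2)"
    unfolding frob_def by (subst sum.swap, rule sum.cong[OF refl], rule sum.swap)
  also have "\<dots> \<le> (\<Sum>x\<in>S. \<Sum>y\<in>S. (mat_pow S A (p + Suc q) x y)\<^sup>2)"
    by (intro sum_mono order_trans[OF sum_power2_le_power2_sum] power_mono le sum_nonneg)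
      (use nn assms(2) in auto)
  finally show ?thesis by (simp add: frob_def)
qed

text \<open>Properness of the labelling means that each row of a label part has at most one nonzero
  entry, so that squares of row sums are sums of squares.\<close>

lemma sum_frob_label_part_proper:
  assumes "finite S" "finite C" "supported S A"
    and col: "\<And>z. z \<in> S \<Longrightarrow> (\<Sum>x\<in>S. (A x z)\<^sup>2) \<le> D"
    and proper: "\<And>x y z. A x y \<noteq> 0 \<Longrightarrow> A x z \<noteq> 0 \<Longrightarrow> \<phi> x y = \<phi> x z \<Longrightarrow> y = z"
  shows "(\<Sum>c\<in>C. frob S (mat_mul S (label_part \<phi> A c) (mat_pow S A q))) \<le> D * frob S (mat_pow S A q)"
proof -
  let ?Q = "mat_pow S A q"
  let ?B = "\<lambda>c. mat_mul S (label_part \<phi> A c) ?Q"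
  have sq: "(?B c x y)\<^sup>2 = (\<Sum>z\<in>S. (label_part \<phi> A c x z)\<^sup>2 * (?Q z y)\<^sup>2)" for c x y
  proof (cases "\<exists>z\<in>S. label_part \<phi> A c x z \<noteq> 0")
    case True
    then obtain z where z: "z \<in> S" "label_part \<phi> A c x z \<noteq> 0" by blast
    have "label_part \<phi> A c x w = 0" if "w \<noteq> z" for w
      using that z proper[of x w z] by (auto simp: label_part_def split: if_splits)
    then have "?B c x y = (\<Sum>w\<in>S. if w = z then label_part \<phi> A c x z * ?Q z y else 0)"
      "(\<Sum>w\<in>S. (label_part \<phi> A c x w)\<^sup>2 * (?Q w y)\<^sup>2) =
        (\<Sum>w\<in>S. if w = z then (label_part \<phi> A c x z)\<^sup>2 * (?Q z y)\<^sup>2 else 0)"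
      unfolding mat_mul_def by (auto intro!: sum.cong)
    then show ?thesis using z assms(1) by (simp add: power_mult_distrib)
  qed (simp add: mat_mul_def)
  have "(\<Sum>c\<in>C. frob S (?B c)) =
      (\<Sum>c\<in>C. \<Sum>x\<in>S. \<Sum>y\<in>S. \<Sum>z\<in>S. (label_part \<phi> A c x z)\<^sup>2 * (?Q z y)\<^sup>2)"
    by (simp add: frob_def sq)
  also have "\<dots> = (\<Sum>x\<in>S. \<Sum>y\<in>S. \<Sum>z\<in>S. (\<Sum>c\<in>C. (label_part \<phi> A c x z)\<^sup>2) * (?Q z y)\<^sup>2)"
    unfolding sum_distrib_right
    by (subst sum.swap, rule sum.cong[OF refl], subst sum.swap, rule sum.cong[OF refl], rule sum.swap)
  also have "\<dots> \<le> (\<Sum>x\<in>S. \<Sum>y\<in>S. \<Sum>z\<in>S. (A x z)\<^sup>2 * (?Q z y)\<^sup>2)"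
  proof (intro sum_mono mult_right_mono)
    fix x z
    have "(\<Sum>c\<in>C. (label_part \<phi> A c x z)\<^sup>2) = (\<Sum>c\<in>C. if \<phi> x z = c then (A x z)\<^sup>2 else 0)"
      by (intro sum.cong) (auto simp: label_part_def)
    also have "\<dots> \<le> (A x z)\<^sup>2" using assms(2) by simp
    finally show "(\<Sum>c\<in>C. (label_part \<phi> A c x z)\<^sup>2) \<le> (A x z)\<^sup>2" .
  qed simp
  \<comment> \<open>Regrouping by the middle vertex \<open>z\<close> isolates the column sums of
    squares of \<open>A\<close>, which \<open>col\<close> bounds by \<open>D\<close>.\<close>
  also have "\<dots> = (\<Sum>z\<in>S. (\<Sum>x\<in>S. (A x z)\<^sup>2) * (\<Sum>y\<in>S. (?Q z y)\<^sup>2))"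
  proof -
    have "(\<Sum>x\<in>S. \<Sum>y\<in>S. \<Sum>z\<in>S. (A x z)\<^sup>2 * (?Q z y)\<^sup>2) =
        (\<Sum>x\<in>S. \<Sum>z\<in>S. \<Sum>y\<in>S. (A x z)\<^sup>2 * (?Q z y)\<^sup>2)"
      by (intro sum.cong refl sum.swap)
    also have "\<dots> = (\<Sum>z\<in>S. \<Sum>x\<in>S. \<Sum>y\<in>S. (A x z)\<^sup>2 * (?Q z y)\<^sup>2)"
      by (rule sum.swap)
    finally show ?thesis by (simp add: sum_product)
  qed
  also have "\<dots> \<le> (\<Sum>z\<in>S. D * (\<Sum>y\<in>S. (?Q z y)\<^sup>2))"
    by (intro sum_mono mult_right_mono col sum_nonneg) auto
  finally show ?thesis by (simp add: frob_def sum_distrib_left)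
qed

text \<open>The longer power is split as \<open>k + (k - a)\<close> and its surplus is rotated to
  the front. The product becomes \<open>P c\<close> with total exponent \<open>Suc k\<close>,
  bounded by nonnegativity, times \<open>Q c\<close>, where properness of \<open>\<psi>\<close>
  turns the labelled factor into the gain \<open>D\<close>.\<close>

lemma sum_trace_two_labels_short_gap:
  assumes "finite S" "finite C" "supported S A" "\<And>x y. A x y \<ge> 0"
    and col: "\<And>z. z \<in> S \<Longrightarrow> (\<Sum>x\<in>S. (A x z)\<^sup>2) \<le> D"
    and proper: "\<And>x y z. A x y \<noteq> 0 \<Longrightarrow> A x z \<noteq> 0 \<Longrightarrow> \<psi> x y = \<psi> x z \<Longrightarrow> y = z"
    and "a + b = 2 * k" "a \<le> k"
  shows "(\<Sum>c\<in>C. mat_trace S (mat_mul S (mat_mul S (label_part \<phi> A c) (mat_pow S A a))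
        (mat_mul S (label_part \<psi> A c) (mat_pow S A b))))\<^sup>2
    \<le> frob S (mat_pow S A (Suc k)) * (D * frob S (mat_pow S A k))"
proof -
  define p where "p = k - a"
  have b: "b = k + p" and k: "k = p + a" using assms(7,8) by (auto simp: p_def)
  let ?U = "\<lambda>c. mat_mul S (label_part \<phi> A c) (mat_pow S A a)"
  let ?P = "\<lambda>c. mat_mul S (mat_pow S A p) (?U c)"
  let ?Q = "\<lambda>c. mat_mul S (label_part \<psi> A c) (mat_pow S A k)"
  have eq: "mat_trace S (mat_mul S (?U c) (mat_mul S (label_part \<psi> A c) (mat_pow S A b)))
      = mat_trace S (mat_mul S (?P c) (?Q c))" for c
  proof -
    have "mat_mul S (?U c) (mat_mul S (label_part \<psi> A c) (mat_pow S A b)) =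
        mat_mul S (mat_mul S (?U c) (?Q c)) (mat_pow S A p)"
      unfolding b mat_pow_add[OF assms(1,3)] by (simp only: mat_mul_assoc)
    then show ?thesis
      by (simp only: mat_trace_cyclic[of S "mat_mul S (?U c) (?Q c)"]) (simp only: mat_mul_assoc)
  qed
  have "(\<Sum>c\<in>C. mat_trace S (mat_mul S (?P c) (?Q c)))\<^sup>2 \<le>
      (\<Sum>c\<in>C. frob S (?P c)) * (\<Sum>c\<in>C. frob S (?Q c))"
    by (rule sum_trace_Cauchy_Schwarz[OF assms(1,2)])
  also have "\<dots> \<le> frob S (mat_pow S A (Suc k)) * (D * frob S (mat_pow S A k))"
  proof (intro mult_mono)
    show "(\<Sum>c\<in>C. frob S (?P c)) \<le> frob S (mat_pow S A (Suc k))"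
      using sum_frob_label_part_le[OF assms(1-4), of p \<phi> a] by (simp add: k)
    show "(\<Sum>c\<in>C. frob S (?Q c)) \<le> D * frob S (mat_pow S A k)"
      by (rule sum_frob_label_part_proper[OF assms(1-3) col proper])
  qed (auto intro: sum_nonneg frob_nonneg)
  finally show ?thesis by (simp only: eq)
qed

text \<open>One of the two gaps is at most \<open>k\<close>. If it is the second, cyclicity of the
  trace exchanges the gaps together with the labellings.\<close>

lemma sum_trace_two_labels:
  assumes "finite S" "finite C" "supported S A" "\<And>x y. A x y \<ge> 0"
    and "\<And>z. z \<in> S \<Longrightarrow> (\<Sum>x\<in>S. (A x z)\<^sup>2) \<le> D"
    and "\<And>x y z. A x y \<noteq> 0 \<Longrightarrow> A x z \<noteq> 0 \<Longrightarrow> \<phi> x y = \<phi> x z \<Longrightarrow> y = z"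
    and "\<And>x y z. A x y \<noteq> 0 \<Longrightarrow> A x z \<noteq> 0 \<Longrightarrow> \<psi> x y = \<psi> x z \<Longrightarrow> y = z"
    and "a + b = 2 * k"
  shows "(\<Sum>c\<in>C. mat_trace S (mat_mul S (mat_mul S (label_part \<phi> A c) (mat_pow S A a))
        (mat_mul S (label_part \<psi> A c) (mat_pow S A b))))\<^sup>2
    \<le> frob S (mat_pow S A (Suc k)) * (D * frob S (mat_pow S A k))"
proof (cases "a \<le> k")
  case True
  show ?thesis
    by (rule sum_trace_two_labels_short_gap) (fact assms True)+
next
  case False
  then have "b + a = 2 * k" "b \<le> k" using assms(8) by auto
  show ?thesis
    by (subst mat_trace_cyclic, rule sum_trace_two_labels_short_gap) (fact assms \<open>b + a = 2 * k\<close> \<open>b \<le> k\<close>)+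
qed

text \<open>With these factors a chain of length \<open>m > j > i\<close> counts the walks whose
  step \<open>i\<close> has \<open>\<phi>\<close>-label \<open>c\<close> and whose step
  \<open>j\<close> has \<open>\<psi>\<close>-label \<open>c\<close>.\<close>

definition two_label_seq ::
  "('a \<Rightarrow> 'a \<Rightarrow> real) \<Rightarrow> nat \<Rightarrow> ('a \<Rightarrow> 'a \<Rightarrow> 'c) \<Rightarrow> nat \<Rightarrow> ('a \<Rightarrow> 'a \<Rightarrow> 'c) \<Rightarrow> 'c \<Rightarrow> nat \<Rightarrow> 'a \<Rightarrow> 'a \<Rightarrow> real"
  where "two_label_seq A i \<phi> j \<psi> c =
    (\<lambda>m. if m = i then label_part \<phi> A c else if m = j then label_part \<psi> A c else A)"

text \<open>The chain is cut at the two labelled factors, and the initial power of exponent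
  \<open>i\<close> is rotated to the end. The two remaining gaps add up to
  \<open>m - 2\<close>.\<close>

lemma trace_two_label_seq:
  assumes "finite S" "supported S A" "i < j" "j < m"
  shows "mat_trace S (mat_chain S (two_label_seq A i \<phi> j \<psi> c) m) =
    mat_trace S (mat_mul S (mat_mul S (label_part \<phi> A c) (mat_pow S A (j - Suc i)))
      (mat_mul S (label_part \<psi> A c) (mat_pow S A ((m - Suc j) + i))))"
proof -
  let ?M = "two_label_seq A i \<phi> j \<psi> c"
  let ?U = "label_part \<phi> A c" and ?V = "label_part \<psi> A c"
  have sup: "supported S (?M l)" for l
    using assms(2) by (auto simp: two_label_seq_def intro: supported_label_part)
  have "m = i + Suc (j - Suc i) + Suc (m - Suc j)" using assms(3,4) by simp
  then have "mat_chain S ?M m = mat_chain S ?M (i + Suc (j - Suc i) + Suc (m - Suc j))"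
    by simp
  also have "\<dots> = mat_mul S (mat_chain S ?M (i + Suc (j - Suc i)))
      (mat_chain S (\<lambda>l. ?M (i + Suc (j - Suc i) + l)) (Suc (m - Suc j)))"
    by (rule mat_chain_add[OF assms(1) sup])
  also have "mat_chain S ?M (i + Suc (j - Suc i)) =
      mat_mul S (mat_chain S ?M i) (mat_chain S (\<lambda>l. ?M (i + l)) (Suc (j - Suc i)))"
    by (rule mat_chain_add[OF assms(1) sup])
  also have "mat_chain S ?M i = mat_pow S A i"
    using assms(3) by (intro mat_chain_cong) (auto simp: two_label_seq_def)
  also have "mat_chain S (\<lambda>l. ?M (i + l)) (Suc (j - Suc i)) = mat_mul S ?U (mat_pow S A (j - Suc i))"
  proof -
    have "mat_chain S (\<lambda>l. ?M (i + l)) (Suc 0 + (j - Suc i)) =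
        mat_mul S (mat_chain S (\<lambda>l. ?M (i + l)) (Suc 0))
          (mat_chain S (\<lambda>l. ?M (i + (Suc 0 + l))) (j - Suc i))"
      by (rule mat_chain_add[OF assms(1) sup])
    moreover have "mat_chain S (\<lambda>l. ?M (i + l)) (Suc 0) = ?U"
      using assms by (simp add: two_label_seq_def mat_mul_one_left supported_label_part)
    moreover have "mat_chain S (\<lambda>l. ?M (i + (Suc 0 + l))) (j - Suc i) = mat_pow S A (j - Suc i)"
      by (intro mat_chain_cong) (auto simp: two_label_seq_def)
    ultimately show ?thesis by simp
  qed
  also have "mat_chain S (\<lambda>l. ?M (i + Suc (j - Suc i) + l)) (Suc (m - Suc j)) =
      mat_mul S ?V (mat_pow S A (m - Suc j))"
  proof -
    have "mat_chain S (\<lambda>l. ?M (i + Suc (j - Suc i) + l)) (Suc 0 + (m - Suc j)) =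
        mat_mul S (mat_chain S (\<lambda>l. ?M (i + Suc (j - Suc i) + l)) (Suc 0))
          (mat_chain S (\<lambda>l. ?M (i + Suc (j - Suc i) + (Suc 0 + l))) (m - Suc j))"
      by (rule mat_chain_add[OF assms(1) sup])
    moreover have "mat_chain S (\<lambda>l. ?M (i + Suc (j - Suc i) + l)) (Suc 0) = ?V"
      using assms by (simp add: two_label_seq_def mat_mul_one_left supported_label_part)
    moreover have "mat_chain S (\<lambda>l. ?M (i + Suc (j - Suc i) + (Suc 0 + l))) (m - Suc j) =
        mat_pow S A (m - Suc j)"
      using assms(3) by (intro mat_chain_cong) (auto simp: two_label_seq_def)
    ultimately show ?thesis by simp
  qed
  finally have "mat_chain S ?M m = mat_mul S (mat_pow S A i)
      (mat_mul S (mat_mul S ?U (mat_pow S A (j - Suc i))) (mat_mul S ?V (mat_pow S A (m - Suc j))))"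
    by (simp only: mat_mul_assoc)
  then show ?thesis
    by (simp only: mat_trace_cyclic[of S "mat_pow S A i"])
      (simp only: mat_mul_assoc mat_pow_add[OF assms(1,2)])
qed

text \<open>The trace of \<open>A ^ 2k\<close> is a weighted count of closed walks. Every walk in which two steps share
  a label is also counted by one of the traces with two label parts.\<close>

lemma frob_le_of_conflicts:
  fixes A :: "'a \<Rightarrow> 'a \<Rightarrow> real" and L :: "('a \<Rightarrow> 'a \<Rightarrow> 'c) set" and D :: real
  assumes "finite S" "supported S A" "\<And>x y. A x y \<ge> 0" "\<And>x y. A x y = A y x"
    and col: "\<And>z. z \<in> S \<Longrightarrow> (\<Sum>x\<in>S. (A x z)\<^sup>2) \<le> D"
    and "D \<ge> 0" "finite L"
    and proper: "\<And>\<phi> x y z. \<phi> \<in> L \<Longrightarrow> A x y \<noteq> 0 \<Longrightarrow> A x z \<noteq> 0 \<Longrightarrow> \<phi> x y = \<phi> x z \<Longrightarrow> y = z"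
    and conflict: "\<And>f. f 0 = f (2 * Suc k) \<Longrightarrow> (\<And>i. i < 2 * Suc k \<Longrightarrow> A (f i) (f (Suc i)) \<noteq> 0) \<Longrightarrow>
      \<exists>j<2 * Suc k. \<exists>i<j. \<exists>\<phi>\<in>L. \<exists>\<psi>\<in>L. \<phi> (f i) (f (Suc i)) = \<psi> (f j) (f (Suc j))"
  shows "frob S (mat_pow S A (Suc k)) \<le> real (2 * Suc k * card L) ^ 4 * D * frob S (mat_pow S A k)"
proof -
  define m where "m = 2 * Suc k"
  define h where "h = (\<lambda>j. frob S (mat_pow S A j))"
  \<comment> \<open>Only labels of pairs from \<open>S\<close> are collected, since the label type
    itself may be infinite.\<close>
  define C where "C = (\<Union>\<phi>\<in>L. (\<lambda>(x, y). \<phi> x y) ` (S \<times> S))"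
  \<comment> \<open>The possible shapes of a conflict: two positions \<open>i < j\<close> and a
    labelling for each, which need not be the same one.\<close>
  define Q where "Q = (SIGMA j:{..<m}. {..<j}) \<times> L \<times> L"
  define M :: "(nat \<times> nat) \<times> ('a \<Rightarrow> 'a \<Rightarrow> 'c) \<times> ('a \<Rightarrow> 'a \<Rightarrow> 'c) \<Rightarrow> 'c \<Rightarrow> nat \<Rightarrow> 'a \<Rightarrow> 'a \<Rightarrow> real"
    where "M = (\<lambda>((j, i), \<phi>, \<psi>) c. two_label_seq A i \<phi> j \<psi> c)"
  define F where "F = {f \<in> {..m} \<rightarrow>\<^sub>E S. f 0 = f m}"
  define w :: "(nat \<Rightarrow> 'a \<Rightarrow> 'a \<Rightarrow> real) \<Rightarrow> (nat \<Rightarrow> 'a) \<Rightarrow> real"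
    where "w = (\<lambda>N f. \<Prod>i<m. N i (f i) (f (Suc i)))"
  have finC: "finite C" and finQ: "finite Q"
    using assms(1,7) by (auto simp: C_def Q_def)
  have finF: "finite F"
    unfolding F_def using assms(1)
    by (intro finite_subset[OF _ finite_PiE[of "{..m}" "\<lambda>_. S"]]) auto
  have Mnn: "M q c l x y \<ge> 0" for q c l x y
    using assms(3) by (auto simp: M_def two_label_seq_def label_part_def split: prod.split)
  have wnn: "w (M q c) f \<ge> 0" for q c f
    unfolding w_def by (intro prod_nonneg) (simp add: Mnn)
  have h_eq: "h (Suc k) = (\<Sum>f\<in>F. w (\<lambda>_. A) f)"
    unfolding h_def frob_pow[OF assms(1,2,4)] F_def w_def m_def
    by (subst mat_trace_chain_walks[OF assms(1)]) (simp add: mult_2)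
  have wle: "w (\<lambda>_. A) f \<le> (\<Sum>q\<in>Q. \<Sum>c\<in>C. w (M q c) f)" if f: "f \<in> F" for f
  proof (cases "w (\<lambda>_. A) f = 0")
    case True
    then show ?thesis by (simp add: sum_nonneg wnn)
  next
    case False
    then have "A (f i) (f (Suc i)) \<noteq> 0" if "i < m" for i
      using that by (auto simp: w_def)
    moreover have "f 0 = f m" using f by (simp add: F_def)
    ultimately obtain j i \<phi> \<psi> where ij: "j < m" "i < j" "\<phi> \<in> L" "\<psi> \<in> L"
      and eq: "\<phi> (f i) (f (Suc i)) = \<psi> (f j) (f (Suc j))"
      using conflict[of f] unfolding m_def by blast
    let ?q = "((j, i), \<phi>, \<psi>)" and ?c = "\<phi> (f i) (f (Suc i))"
    have q: "?q \<in> Q" using ij by (simp add: Q_def)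
    have "f i \<in> S" "f (Suc i) \<in> S" using f ij by (auto simp: F_def PiE_iff)
    then have c: "?c \<in> C" using ij by (force simp: C_def)
    \<comment> \<open>Both restricted factors keep their value on this walk because its steps
      \<open>i\<close> and \<open>j\<close> carry the common label \<open>?c\<close>.\<close>
    have "w (\<lambda>_. A) f = w (M ?q ?c) f"
      unfolding w_def M_def using eq by (intro prod.cong) (auto simp: two_label_seq_def label_part_def)
    also have "\<dots> \<le> (\<Sum>c\<in>C. w (M ?q c) f)"
      using c finC wnn by (intro member_le_sum) auto
    also have "\<dots> \<le> (\<Sum>q\<in>Q. \<Sum>c\<in>C. w (M q c) f)"
      using q finQ wnn by (intro member_le_sum[of ?q Q "\<lambda>q. \<Sum>c\<in>C. w (M q c) f"] sum_nonneg) auto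
    finally show ?thesis .
  qed
  define B where "B = h (Suc k) * (D * h k)"
  have hnn: "h j \<ge> 0" for j by (simp add: h_def frob_nonneg)
  have Bnn: "B \<ge> 0" using hnn assms(6) by (simp add: B_def)
  have tr: "(\<Sum>c\<in>C. mat_trace S (mat_chain S (M q c) m)) \<le> sqrt B" if q: "q \<in> Q" for q
  proof -
    obtain j i \<phi> \<psi> where q': "q = ((j, i), \<phi>, \<psi>)" "j < m" "i < j" "\<phi> \<in> L" "\<psi> \<in> L"
      using q by (auto simp: Q_def)
    have ab: "(j - Suc i) + ((m - Suc j) + i) = 2 * k" using q' by (simp add: m_def)
    have "(\<Sum>c\<in>C. mat_trace S (mat_chain S (M q c) m))\<^sup>2 \<le> B"
      unfolding q' M_def prod.case trace_two_label_seq[OF assms(1,2) q'(3,2)] B_def h_def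
      by (rule sum_trace_two_labels) (fact assms(1-3) finC col proper[OF q'(4)] proper[OF q'(5)] ab)+
    then show ?thesis by (rule real_le_rsqrt)
  qed
  have "h (Suc k) \<le> (\<Sum>f\<in>F. \<Sum>q\<in>Q. \<Sum>c\<in>C. w (M q c) f)"
    unfolding h_eq by (intro sum_mono wle)
  also have "\<dots> = (\<Sum>q\<in>Q. \<Sum>c\<in>C. \<Sum>f\<in>F. w (M q c) f)"
    by (subst sum.swap, rule sum.cong[OF refl], rule sum.swap)
  also have "\<dots> = (\<Sum>q\<in>Q. \<Sum>c\<in>C. mat_trace S (mat_chain S (M q c) m))"
    by (simp only: w_def F_def mat_trace_chain_walks[OF assms(1)])
  also have "\<dots> \<le> real (card Q) * sqrt B"
    using tr by (intro sum_bounded_above)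
  also have "\<dots> \<le> (real (m * card L))\<^sup>2 * sqrt B"
  proof -
    have "card Q \<le> card (({..<m} \<times> {..<m}) \<times> L \<times> L)"
      using assms(7) by (intro card_mono) (auto simp: Q_def)
    then have "card Q \<le> (m * card L)\<^sup>2"
      by (simp add: card_cartesian_product power2_eq_square mult_ac)
    then have "real (card Q) \<le> real ((m * card L)\<^sup>2)"
      using of_nat_le_iff by blast
    then show ?thesis using Bnn by (intro mult_right_mono) auto
  qed
  \<comment> \<open>\<open>B\<close> contains a factor \<open>h (Suc k)\<close>. Squaring and
    cancelling it leaves a linear bound, with the fourth power of \<open>m * card L\<close> as its
    price.\<close>
  finally have "(h (Suc k))\<^sup>2 \<le> ((real (m * card L))\<^sup>2 * sqrt B)\<^sup>2"
    using hnn by (intro power_mono)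
  also have "\<dots> = h (Suc k) * (real (m * card L) ^ 4 * D * h k)"
    using Bnn by (simp add: power_mult_distrib B_def)
  finally have "h (Suc k) * h (Suc k) \<le> h (Suc k) * (real (m * card L) ^ 4 * D * h k)"
    by (simp add: power2_eq_square)
  then have "h (Suc k) \<le> real (m * card L) ^ 4 * D * h k"
    using hnn[of k] hnn[of "Suc k"] assms(6)
    by (cases "h (Suc k) = 0") (auto simp: mult_le_cancel_left)
  then show ?thesis by (simp add: h_def m_def)
qed

text \<open>No eigenvectors are needed: the squared norms \<open>s j\<close> of \<open>A ^ j\<close>
  applied to \<open>u\<close> form a log-convex sequence, and Cauchy-Schwarz on the Rayleigh
  quotient bounds the first ratio below by the square of \<open>r\<close>. The squared Frobenius
  norm dominates \<open>s k / s 0\<close>.\<close>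

lemma frob_pow_ge_Rayleigh:
  fixes u :: "'a \<Rightarrow> real"
  assumes "finite S" "supported S A" "\<And>x y. A x y = A y x"
    and upos: "(\<Sum>x\<in>S. (u x)\<^sup>2) > 0"
    and rayleigh: "(\<Sum>x\<in>S. \<Sum>y\<in>S. u x * A x y * u y) = r * (\<Sum>x\<in>S. (u x)\<^sup>2)" and "r > 0"
  shows "frob S (mat_pow S A k) \<ge> (r\<^sup>2) ^ k"
proof -
  define v where "v = (\<lambda>j x. \<Sum>y\<in>S. mat_pow S A j x y * u y)"
  define s where "s = (\<lambda>j. \<Sum>x\<in>S. (v j x)\<^sup>2)"
  have v_add: "v (a + b) x = (\<Sum>z\<in>S. mat_pow S A a x z * v b z)" for a b x
  proof -
    have "v (a + b) x = (\<Sum>y\<in>S. \<Sum>z\<in>S. mat_pow S A a x z * mat_pow S A b z y * u y)"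
      unfolding v_def mat_pow_add[OF assms(1,2)] by (simp add: mat_mul_def sum_distrib_right)
    also have "\<dots> = (\<Sum>z\<in>S. \<Sum>y\<in>S. mat_pow S A a x z * mat_pow S A b z y * u y)"
      by (rule sum.swap)
    finally show ?thesis by (simp add: v_def sum_distrib_left mult.assoc)
  qed
  have shift: "(\<Sum>x\<in>S. v a x * v b x) = (\<Sum>x\<in>S. u x * v (a + b) x)" for a b
  proof -
    have "(\<Sum>x\<in>S. u x * v (a + b) x) = (\<Sum>x\<in>S. \<Sum>z\<in>S. u x * mat_pow S A a x z * v b z)"
      by (simp add: v_add sum_distrib_left mult.assoc)
    also have "\<dots> = (\<Sum>z\<in>S. \<Sum>x\<in>S. u x * mat_pow S A a x z * v b z)"
      by (rule sum.swap)
    also have "\<dots> = (\<Sum>z\<in>S. \<Sum>x\<in>S. mat_pow S A a z x * u x * v b z)"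
      by (intro sum.cong refl) (metis mat_pow_sym[OF assms(1-3)] mult.commute)
    finally show ?thesis by (simp add: v_def sum_distrib_right)
  qed
  have v0: "v 0 x = u x" if "x \<in> S" for x
  proof -
    have "v 0 x = (\<Sum>y\<in>S. if y = x then u x else 0)"
      unfolding v_def mat_chain.simps mat_one_def by (rule sum.cong) auto
    then show ?thesis using that assms(1) by simp
  qed
  have s0: "s 0 = (\<Sum>x\<in>S. (u x)\<^sup>2)"
    unfolding s_def by (simp add: v0)
  have s_convex: "(s (Suc j))\<^sup>2 \<le> s j * s (Suc (Suc j))" for j
  proof -
    \<comment> \<open>By symmetry one factor \<open>A\<close> moves across the inner product, which
      now pairs the iterates \<open>j\<close> and \<open>j + 2\<close>.\<close>
    have "s (Suc j) = (\<Sum>x\<in>S. v j x * v (Suc (Suc j)) x)"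
      using shift[of "Suc j" "Suc j"] shift[of j "Suc (Suc j)"] by (simp add: s_def power2_eq_square)
    then show ?thesis
      unfolding s_def by (simp add: Cauchy_Schwarz_ineq_sum)
  qed
  have "(\<Sum>x\<in>S. u x * v 1 x) = r * s 0"
    using rayleigh mat_pow_one[OF assms(1,2)]
    by (simp add: v_def s0 sum_distrib_left mult.assoc)
  moreover have "(\<Sum>x\<in>S. u x * v 1 x)\<^sup>2 \<le> s 0 * s 1"
    unfolding s0 unfolding s_def by (rule Cauchy_Schwarz_ineq_sum)
  ultimately have "s 0 * (r\<^sup>2 * s 0) \<le> s 0 * s 1"
    by (simp add: power2_eq_square mult_ac)
  then have "s 1 \<ge> r\<^sup>2 * s 0" using upos s0 by simp
  with s_convex have "(r\<^sup>2) ^ k * s 0 \<le> s k"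
    by (intro log_convex_growth) (use upos s0 assms(6) in auto)
  also have "s k \<le> (\<Sum>x\<in>S. (\<Sum>y\<in>S. (mat_pow S A k x y)\<^sup>2) * (\<Sum>y\<in>S. (u y)\<^sup>2))"
    unfolding s_def v_def by (intro sum_mono Cauchy_Schwarz_ineq_sum)
  also have "\<dots> = frob S (mat_pow S A k) * s 0"
    by (simp add: frob_def s0 sum_distrib_right)
  finally show ?thesis using upos s0 by simp
qed

text \<open>The normalization \<open>1 / sqrt ((d x + \<delta>) (d y + \<delta>))\<close> keeps all column sums of squares below
  \<open>1 / \<delta>\<close> while the largest eigenvalue stays at least \<open>1 / 2\<close>, so no regularization of the
  graph is needed.\<close>

lemma conflict_free_closed_walk:
  fixes R :: "'a \<Rightarrow> 'a \<Rightarrow> bool" and L :: "('a \<Rightarrow> 'a \<Rightarrow> 'c) set" and \<delta> :: real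
  assumes "finite S" "S \<noteq> {}" "\<And>x y. R x y \<Longrightarrow> x \<in> S \<and> y \<in> S" "\<And>x y. R x y \<Longrightarrow> R y x"
    and "finite L"
    and proper: "\<And>\<phi> x y z. \<phi> \<in> L \<Longrightarrow> R x y \<Longrightarrow> R x z \<Longrightarrow> \<phi> x y = \<phi> x z \<Longrightarrow> y = z"
    and "k > 0" "\<delta> > 0" "\<delta> * card S = (\<Sum>x\<in>S. real (card {y. R x y}))"
    and dense: "(4 * real (2 * k * card L) ^ 4) ^ k * card S < \<delta> ^ k"
  obtains f where "f 0 = f (2 * k)" "\<And>i. i < 2 * k \<Longrightarrow> R (f i) (f (Suc i))"
    "\<And>i j \<phi> \<psi>. i < j \<Longrightarrow> j < 2 * k \<Longrightarrow> \<phi> \<in> L \<Longrightarrow> \<psi> \<in> L \<Longrightarrow>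
      \<phi> (f i) (f (Suc i)) \<noteq> \<psi> (f j) (f (Suc j))"
proof (rule ccontr)
  assume "\<not> thesis"
  note walk = that
  have conflict: "\<exists>j<2 * k. \<exists>i<j. \<exists>\<phi>\<in>L. \<exists>\<psi>\<in>L. \<phi> (f i) (f (Suc i)) = \<psi> (f j) (f (Suc j))"
    if f: "f 0 = f (2 * k)" "\<And>i. i < 2 * k \<Longrightarrow> R (f i) (f (Suc i))" for f
  proof (rule ccontr)
    assume "\<not> ?thesis"
    then have "\<phi> (f i) (f (Suc i)) \<noteq> \<psi> (f j) (f (Suc j))"
      if "i < j" "j < 2 * k" "\<phi> \<in> L" "\<psi> \<in> L" for i j \<phi> \<psi>
      using that by blast
    with f show False using walk[of f] \<open>\<not> thesis\<close> by metis
  qed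
  define d where "d = (\<lambda>x. real (card {y. R x y}))"
  define u where "u = (\<lambda>x. sqrt (d x + \<delta>))"
  define A where "A = (\<lambda>x y. if R x y then 1 / (u x * u y) else 0)"
  define h where "h = (\<lambda>j. frob S (mat_pow S A j))"
  have dnn: "d x \<ge> 0" for x by (simp add: d_def)
  have upos: "u x > 0" for x using dnn[of x] assms(8) by (simp add: u_def)
  have u2: "(u x)\<^sup>2 = d x + \<delta>" for x using dnn[of x] assms(8) by (simp add: u_def)
  have A0: "A x y \<noteq> 0 \<longleftrightarrow> R x y" for x y
    using upos[of x] upos[of y] by (simp add: A_def)
  have sup: "supported S A" using assms(3) by (auto simp: supported_def A0)
  have Ann: "A x y \<ge> 0" for x y using upos[of x] upos[of y] by (simp add: A_def)
  have Asym: "A x y = A y x" for x y using assms(4) by (auto simp: A_def)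
  have sum_R: "(\<Sum>y\<in>S. if R x y then c else 0) = d x * c" for x and c :: real
  proof -
    have "(\<Sum>y\<in>S. if R x y then c else 0) = (\<Sum>y\<in>{y. R x y}. c)"
      using assms(1,3) by (intro sum.mono_neutral_cong_right) auto
    then show ?thesis by (simp add: d_def)
  qed
  have col: "(\<Sum>x\<in>S. (A x z)\<^sup>2) \<le> 1 / \<delta>" for z
  proof -
    have "(\<Sum>x\<in>S. (A x z)\<^sup>2) \<le> (\<Sum>x\<in>S. if R z x then 1 / ((d z + \<delta>) * \<delta>) else 0)"
    proof (rule sum_mono)
      fix x
      have "1 / ((d z + \<delta>) * (d x + \<delta>)) \<le> 1 / ((d z + \<delta>) * \<delta>)"
        using dnn[of x] dnn[of z] assms(8)
        by (intro divide_left_mono mult_left_mono mult_pos_pos) auto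
      then show "(A x z)\<^sup>2 \<le> (if R z x then 1 / ((d z + \<delta>) * \<delta>) else 0)"
        unfolding Asym[of x z] by (simp add: A_def power_divide power_mult_distrib u2)
    qed
    also have "\<dots> = d z / (d z + \<delta>) * (1 / \<delta>)"
      by (simp add: sum_R)
    also have "\<dots> \<le> 1 * (1 / \<delta>)"
      using dnn[of z] assms(8) by (intro mult_right_mono) auto
    finally show ?thesis by simp
  qed
  have sum_u2: "(\<Sum>x\<in>S. (u x)\<^sup>2) = 2 * \<delta> * card S"
    using assms(9) by (simp add: u2 sum.distrib d_def)
  have "card S > 0" using assms(1,2) by (simp add: card_gt_0_iff)
  \<comment> \<open>The test vector is \<open>u\<close>: its quadratic form is the sum of the
    degrees, and its squared norm is twice that because \<open>\<delta>\<close> is the average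
    degree. Hence the Rayleigh quotient is \<open>1/2\<close>.\<close>
  have "(1/4) ^ k \<le> h k"
  proof -
    have "((1/2)\<^sup>2) ^ k \<le> h k"
      unfolding h_def
    proof (rule frob_pow_ge_Rayleigh[OF assms(1) sup Asym])
      have "(\<Sum>y\<in>S. u x * A x y * u y) = d x" for x
      proof -
        have "(\<Sum>y\<in>S. u x * A x y * u y) = (\<Sum>y\<in>S. if R x y then 1 else 0)"
          using upos by (intro sum.cong refl) (simp add: A_def less_imp_neq[symmetric])
        then show ?thesis using sum_R[of x 1] by simp
      qed
      then show "(\<Sum>x\<in>S. \<Sum>y\<in>S. u x * A x y * u y) = 1 / 2 * (\<Sum>x\<in>S. (u x)\<^sup>2)"
        using assms(9) by (simp add: sum_u2 d_def)
      show "(\<Sum>x\<in>S. (u x)\<^sup>2) > 0"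
        using \<open>card S > 0\<close> assms(8) by (simp add: sum_u2)
    qed simp
    then show ?thesis by (simp add: power2_eq_square)
  qed
  moreover have "h k \<le> (real (2 * k * card L) ^ 4 * (1 / \<delta>)) ^ k * card S"
  proof -
    obtain k' where k: "k = Suc k'" using assms(7) gr0_implies_Suc by blast
    have "h (Suc k') \<le> real (2 * Suc k' * card L) ^ 4 * (1 / \<delta>) * h k'"
      unfolding h_def
    proof (rule frob_le_of_conflicts[OF assms(1) sup Ann Asym col _ assms(5)])
      show "1 / \<delta> \<ge> 0" using assms(8) by simp
      show "y = z" if "\<phi> \<in> L" "A x y \<noteq> 0" "A x z \<noteq> 0" "\<phi> x y = \<phi> x z" for \<phi> x y z
        using that proper by (simp add: A0)
      show "\<exists>j<2 * Suc k'. \<exists>i<j. \<exists>\<phi>\<in>L. \<exists>\<psi>\<in>L. \<phi> (f i) (f (Suc i)) = \<psi> (f j) (f (Suc j))"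
        if "f 0 = f (2 * Suc k')" "\<And>i. i < 2 * Suc k' \<Longrightarrow> A (f i) (f (Suc i)) \<noteq> 0" for f
        using conflict[of f] that by (simp only: k A0)
    qed
    \<comment> \<open>The conflicts bound only the last ratio of even moments. Log-convexity extends
      the bound down to \<open>h 0\<close>, the trace of the identity.\<close>
    then have "h (Suc k') \<le> (real (2 * Suc k' * card L) ^ 4 * (1 / \<delta>)) ^ Suc k' * h 0"
    proof (intro log_convex_decay)
      show "(h (Suc m))\<^sup>2 \<le> h m * h (Suc (Suc m))" for m
        unfolding h_def by (rule frob_pow_log_convex[OF assms(1) sup Asym])
    qed (use assms(8) in \<open>auto simp: h_def frob_nonneg\<close>)
    moreover have "h 0 = card S"
    proof -
      have "h 0 = (\<Sum>x\<in>S. \<Sum>y\<in>S. if x = y then 1 else 0)"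
        unfolding h_def frob_def mat_chain.simps mat_one_def by (intro sum.cong) auto
      then show ?thesis using assms(1) by simp
    qed
    ultimately show ?thesis by (simp only: k)
  qed
  ultimately have "(1/4) ^ k \<le> (real (2 * k * card L) ^ 4 * (1 / \<delta>)) ^ k * card S"
    by linarith
  then have "(4 * \<delta>) ^ k * (1/4) ^ k \<le> (4 * \<delta>) ^ k * ((real (2 * k * card L) ^ 4 * (1 / \<delta>)) ^ k * card S)"
    using assms(8) by (intro mult_left_mono) auto
  moreover have "(4 * \<delta>) ^ k * (1/4) ^ k = \<delta> ^ k"
    by (subst power_mult_distrib[symmetric]) simp
  moreover have "(4 * \<delta>) ^ k * ((real (2 * k * card L) ^ 4 * (1 / \<delta>)) ^ k * card S)
      = (4 * real (2 * k * card L) ^ 4) ^ k * card S"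
  proof -
    have "(4 * \<delta>) * (c * (1 / \<delta>)) = 4 * c" for c
      using assms(8) by simp
    then show ?thesis
      by (simp only: mult.assoc[symmetric] power_mult_distrib[symmetric])
  qed
  ultimately show False using dense by linarith
qed

section \<open>The graph on pairs of vertices\<close>

text \<open>Each \<open>v i\<close> lies in exactly the two edges of index \<open>i\<close>. Each
  \<open>a i\<close> lies in the first-family edges of index \<open>i\<close> and of the
  \<open>p\<close>-preimage of \<open>i\<close>, and \<open>b i\<close> likewise in the second
  family. Since \<open>p\<close> has no fixed points, these indices differ, and the edges differ
  because only one of them contains \<open>v i\<close>.\<close>

lemma two_regular_of_cyclic_edges:
  fixes a b v :: "nat \<Rightarrow> 'a"
  assumes I: "finite I" "I \<noteq> {}" and p: "bij_betw p I I" "\<And>i. i \<in> I \<Longrightarrow> p i \<noteq> i"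
    and inj: "inj_on a I" "inj_on b I" "inj_on v I"
    and disj: "a ` I \<inter> b ` I = {}" "a ` I \<inter> v ` I = {}" "b ` I \<inter> v ` I = {}"
  defines "F \<equiv> (\<lambda>i. {v i, a (p i), a i}) ` I \<union> (\<lambda>i. {v i, b (p i), b i}) ` I"
  shows "two_regular (\<Union>F) F"
proof -
  let ?e = "\<lambda>i. {v i, a (p i), a i}" and ?g = "\<lambda>i. {v i, b (p i), b i}"
  have pI: "p i \<in> I" if "i \<in> I" for i using p(1) that by (auto simp: bij_betw_def)
  have ne: "a i \<noteq> b j" "a i \<noteq> v j" "b i \<noteq> v j" "b j \<noteq> a i" "v j \<noteq> a i" "v j \<noteq> b i"
    if "i \<in> I" "j \<in> I" for i j
    using that disj by blast+
  have eqI: "a i = a j \<longleftrightarrow> i = j" "b i = b j \<longleftrightarrow> i = j" "v i = v j \<longleftrightarrow> i = j"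
    "p i = p j \<longleftrightarrow> i = j" if "i \<in> I" "j \<in> I" for i j
    using that inj p(1) by (auto simp: bij_betw_def inj_on_def)
  have deg_v: "degree F (v i) = 2" if i: "i \<in> I" for i
  proof -
    have "{e \<in> F. v i \<in> e} = {?e i, ?g i}"
      using i by (auto simp: F_def ne eqI pI)
    moreover have "?e i \<noteq> ?g i"
      using i ne(1)[of i "p i"] ne(1)[of i i] ne(2)[of i i] pI by auto
    ultimately show ?thesis by (simp add: degree_def)
  qed
  have deg_ab: "degree F (a i) = 2" "degree F (b i) = 2" if i: "i \<in> I" for i
  proof -
    obtain j where j: "j \<in> I" "p j = i"
      using p(1) i by (metis bij_betw_iff_bijections)
    have ij: "j \<noteq> i" using p(2)[OF j(1)] j(2) by auto
    have pj: "p l = i \<longleftrightarrow> l = j" if "l \<in> I" for l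
      using eqI(4)[OF that j(1)] j(2) by simp
    have mem: "a i \<in> ?e l \<longleftrightarrow> l = i \<or> l = j" "a i \<notin> ?g l" "b i \<in> ?g l \<longleftrightarrow> l = i \<or> l = j" "b i \<notin> ?e l"
      if l: "l \<in> I" for l
    proof -
      have "a i = a (p l) \<longleftrightarrow> l = j" "b i = b (p l) \<longleftrightarrow> l = j"
        using eqI(1,2)[OF i pI[OF l]] pj[OF l] by metis+
      moreover have "a i = a l \<longleftrightarrow> l = i" "b i = b l \<longleftrightarrow> l = i"
        using eqI(1,2)[OF i l] by metis+
      ultimately show "a i \<in> ?e l \<longleftrightarrow> l = i \<or> l = j" "a i \<notin> ?g l"
        "b i \<in> ?g l \<longleftrightarrow> l = i \<or> l = j" "b i \<notin> ?e l"
        using ne(1,2,3)[OF i l] ne(1)[OF i pI[OF l]] ne(4)[OF l i] ne(4)[OF pI[OF l] i]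
        unfolding insert_iff empty_iff by blast+
    qed
    \<comment> \<open>Stated for arbitrary families so that it serves \<open>a i\<close> and, with
      the families exchanged, \<open>b i\<close>.\<close>
    have star: "{e \<in> P ` I \<union> Q ` I. x \<in> e} = {P i, P j}"
      if "\<And>l. l \<in> I \<Longrightarrow> x \<in> P l \<longleftrightarrow> l = i \<or> l = j" "\<And>l. l \<in> I \<Longrightarrow> x \<notin> Q l"
      for x and P Q :: "nat \<Rightarrow> 'a set"
      using that i j(1) by auto
    have "{e \<in> ?e ` I \<union> ?g ` I. a i \<in> e} = {?e i, ?e j}"
      by (rule star; rule mem)
    moreover have "{e \<in> ?g ` I \<union> ?e ` I. b i \<in> e} = {?g i, ?g j}"
      by (rule star; rule mem)
    ultimately have "{e \<in> F. a i \<in> e} = {?e i, ?e j}" "{e \<in> F. b i \<in> e} = {?g i, ?g j}"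
      unfolding F_def by (simp_all only: Un_commute)
    moreover have "v i \<notin> ?e j" "v i \<notin> ?g j"
      using i j ij by (auto simp: ne eqI pI)
    then have "?e i \<noteq> ?e j" "?g i \<noteq> ?g j" by blast+
    ultimately show "degree F (a i) = 2" "degree F (b i) = 2"
      by (simp_all add: degree_def)
  qed
  have "\<Union>F \<subseteq> v ` I \<union> a ` I \<union> b ` I" using pI by (auto simp: F_def)
  then have "\<forall>x\<in>\<Union>F. degree F x = 2" using deg_v deg_ab by blast
  moreover have "F \<noteq> {}" using I by (simp add: F_def)
  ultimately show ?thesis by (simp add: two_regular_def)
qed

section \<open>Linear triple systems and the graph on pairs\<close>

lemma linear_edge_eq:
  assumes "uniform 3 E" "linear_hypergraph E" "e \<in> E" "e' \<in> E"
    and "x \<noteq> y" "x \<in> e" "y \<in> e" "x \<in> e'" "y \<in> e'"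
  shows "e = e'"
proof (rule ccontr)
  assume "e \<noteq> e'"
  then have "card (e \<inter> e') \<le> 1" using assms by (simp add: linear_hypergraph_def)
  moreover have "finite e" using assms(1,3) by (intro card_ge_0_finite) (simp add: uniform_def)
  then have "card {x, y} \<le> card (e \<inter> e')"
    using assms(6-9) by (intro card_mono) auto
  ultimately show False using assms(5) by simp
qed

lemma triple_distinct:
  assumes "uniform 3 E" "{x, y, z} \<in> E"
  shows "x \<noteq> y" "x \<noteq> z" "y \<noteq> z"
proof -
  have c: "card {x, y, z} = 3" using assms by (simp add: uniform_def)
  show "x \<noteq> y" "x \<noteq> z" "y \<noteq> z"
    using c by (auto simp: card_insert_if split: if_splits)
qed

lemma triple_third_unique:
  assumes "uniform 3 E" "linear_hypergraph E" "{x, y, z} \<in> E" "{x, y, z'} \<in> E"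
  shows "z = z'"
proof -
  have "{x, y, z} = {x, y, z'}"
    using linear_edge_eq[OF assms, of x y] triple_distinct[OF assms(1,3)] by simp
  then have "z \<in> {x, y, z'}" by blast
  then show ?thesis
    using triple_distinct[OF assms(1,3)] by auto
qed

text \<open>The common vertex \<open>v\<close> is an explicit argument because it is one of the
  labels of the step. Requiring distinct edges excludes steps whose own labels coincide.\<close>

definition pair_adj :: "'a set set \<Rightarrow> 'a \<times> 'a \<Rightarrow> 'a \<times> 'a \<Rightarrow> 'a \<Rightarrow> bool" where
  "pair_adj E p q v \<longleftrightarrow> {v, fst p, fst q} \<in> E \<and> {v, snd p, snd q} \<in> E \<and>
    {v, fst p, fst q} \<noteq> {v, snd p, snd q}"

lemma pair_adj_sym: "pair_adj E p q v \<Longrightarrow> pair_adj E q p v"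
  by (simp add: pair_adj_def insert_commute)

lemma pair_adj_in_square:
  assumes "E \<subseteq> Pow V" "pair_adj E p q v"
  shows "p \<in> V \<times> V \<and> q \<in> V \<times> V"
proof -
  have "{v, fst p, fst q} \<in> E" "{v, snd p, snd q} \<in> E"
    using assms(2) by (auto simp: pair_adj_def)
  with assms(1) have "{v, fst p, fst q} \<subseteq> V" "{v, snd p, snd q} \<subseteq> V" by blast+
  then show ?thesis by (auto simp: mem_Times_iff)
qed

text \<open>If \<open>fst q = snd q\<close>, the two edges share this vertex and \<open>v\<close>,
  so linearity would identify them.\<close>

lemma pair_adj_distinct:
  assumes "uniform 3 E" "linear_hypergraph E" "pair_adj E p q v"
  shows "fst q \<noteq> snd q" "fst q \<noteq> v" "snd q \<noteq> v"
proof -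
  from assms(3) have *: "{v, fst p, fst q} \<in> E" "{v, snd p, snd q} \<in> E"
    "{v, fst p, fst q} \<noteq> {v, snd p, snd q}" by (auto simp: pair_adj_def)
  show "fst q \<noteq> v" "snd q \<noteq> v"
    using triple_distinct[OF assms(1) *(1)] triple_distinct[OF assms(1) *(2)] by auto
  then show "fst q \<noteq> snd q"
    using linear_edge_eq[OF assms(1,2) *(1,2), of v "fst q"] *(3) by auto
qed

text \<open>Two vertices of an edge determine the third. A common first or second coordinate of the
  targets fixes \<open>v\<close> through the corresponding edge, and then \<open>v\<close> with the
  coordinates of \<open>p\<close> fixes \<open>q\<close>. This makes all three labellings
  proper.\<close>

lemma pair_adj_unique:
  assumes "uniform 3 E" "linear_hypergraph E" "pair_adj E p q v" "pair_adj E p q' v'"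
    and "fst q = fst q' \<or> snd q = snd q' \<or> v = v'"
  shows "q = q'" "v = v'"
proof -
  from assms(3,4) have e: "{v, fst p, fst q} \<in> E" "{v, snd p, snd q} \<in> E"
    "{v', fst p, fst q'} \<in> E" "{v', snd p, snd q'} \<in> E" by (auto simp: pair_adj_def)
  note third = triple_third_unique[OF assms(1,2)]
  show v: "v = v'"
    using assms(5) e third[of "fst p" "fst q" v v'] third[of "snd p" "snd q" v v']
    by (auto simp: insert_commute)
  show "q = q'"
    using v e third[of v "fst p" "fst q" "fst q'"] third[of v "snd p" "snd q" "snd q'"]
    by (auto simp: prod_eq_iff)
qed

text \<open>Every vertex of the closed walk is named by the step that enters it, so the tail of a
  step is the head of its cyclic predecessor. Disjoint labels then give the configuration of
  \<open>two_regular_of_cyclic_edges\<close>, with two edges per step.\<close>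

lemma two_regular_of_pair_walk:
  fixes f :: "nat \<Rightarrow> 'a \<times> 'a" and v :: "nat \<Rightarrow> 'a"
  assumes E: "uniform 3 E" "linear_hypergraph E" and "m \<ge> 2"
    and f: "f 0 = f m" "\<And>i. i < m \<Longrightarrow> pair_adj E (f i) (f (Suc i)) (v i)"
    and labels: "\<And>i j. i < j \<Longrightarrow> j < m \<Longrightarrow>
      {fst (f (Suc i)), snd (f (Suc i)), v i} \<inter> {fst (f (Suc j)), snd (f (Suc j)), v j} = {}"
  shows "has_two_regular_sub E (2 * m)"
proof -
  define a b where "a = (\<lambda>i. fst (f (Suc i)))" and "b = (\<lambda>i. snd (f (Suc i)))"
  \<comment> \<open>The cyclic predecessor, free of fixed points as \<open>m \<ge> 2\<close>. At
    \<open>i = 0\<close> the identification with the head of step \<open>m - 1\<close> uses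
    \<open>f 0 = f m\<close>.\<close>
  define p where "p = (\<lambda>i::nat. if i = 0 then m - 1 else i - 1)"
  let ?I = "{..<m}"
  define F where "F = (\<lambda>i. {v i, a (p i), a i}) ` ?I \<union> (\<lambda>i. {v i, b (p i), b i}) ` ?I"
  have prev: "fst (f i) = a (p i)" "snd (f i) = b (p i)" if "i < m" for i
    using that f(1) assms(3) by (auto simp: a_def b_def p_def)
  have disj: "{a i, b i, v i} \<inter> {a j, b j, v j} = {}" if "i \<noteq> j" "i < m" "j < m" for i j
    using labels[of i j] labels[of j i] that by (cases "i < j") (auto simp: a_def b_def)
  have local: "a i \<noteq> b i" "a i \<noteq> v i" "b i \<noteq> v i" if "i < m" for i
    using pair_adj_distinct[OF E f(2)[OF that]] by (auto simp: a_def b_def)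
  have "bij_betw p ?I ?I"
    by (rule bij_betw_byWitness[where f' = "\<lambda>i. if Suc i = m then 0 else Suc i"])
      (use assms(3) in \<open>auto simp: p_def\<close>)
  moreover have "p i \<noteq> i" if "i \<in> ?I" for i using assms(3) by (auto simp: p_def)
  moreover have "inj_on a ?I" "inj_on b ?I" "inj_on v ?I"
  proof -
    have "a i \<noteq> a j \<and> b i \<noteq> b j \<and> v i \<noteq> v j" if "i \<noteq> j" "i < m" "j < m" for i j
      using disj[OF that] by blast
    then show "inj_on a ?I" "inj_on b ?I" "inj_on v ?I"
      unfolding inj_on_def lessThan_iff by blast+
  qed
  moreover have "a ` ?I \<inter> b ` ?I = {}" "a ` ?I \<inter> v ` ?I = {}" "b ` ?I \<inter> v ` ?I = {}"
  proof -
    have "a i \<noteq> b j \<and> a i \<noteq> v j \<and> b i \<noteq> v j" if "i < m" "j < m" for i j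
      using disj[of i j] local[of i] that by (cases "i = j") auto
    then show "a ` ?I \<inter> b ` ?I = {}" "a ` ?I \<inter> v ` ?I = {}" "b ` ?I \<inter> v ` ?I = {}"
      by blast+
  qed
  ultimately have "two_regular (\<Union>F) F"
    unfolding F_def using assms(3)
    by (intro two_regular_of_cyclic_edges) (auto simp: lessThan_empty_iff)
  moreover have "F \<subseteq> E"
    using f(2) prev by (auto simp: F_def pair_adj_def a_def b_def)
  moreover have "card F \<le> 2 * m"
  proof -
    have "card F \<le> card ((\<lambda>i. {v i, a (p i), a i}) ` ?I) + card ((\<lambda>i. {v i, b (p i), b i}) ` ?I)"
      unfolding F_def by (rule card_Un_le)
    also have "\<dots> \<le> card ?I + card ?I"
      by (intro add_mono card_image_le) auto
    finally show ?thesis by simp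
  qed
  ultimately show ?thesis unfolding has_two_regular_sub_def by blast
qed

text \<open>Here \<open>\<delta>\<close> is the average degree of the graph on
  \<open>V \<times> V\<close>. A conflict-free closed walk of length \<open>2k\<close> in it yields
  at most \<open>4k\<close> edges.\<close>

lemma has_two_regular_sub_of_dense_pairs:
  fixes E :: "'a set set" and \<delta> :: real
  assumes "finite V" "E \<subseteq> Pow V" "V \<noteq> {}"
    and E: "uniform 3 E" "linear_hypergraph E" and "k > 0" "\<delta> > 0"
    and \<delta>: "\<delta> * (card V)\<^sup>2 = card {(p, q). \<exists>v. pair_adj E p q v}"
    and dense: "(4 * (6 * real k) ^ 4) ^ k * (card V)\<^sup>2 < \<delta> ^ k"
  shows "has_two_regular_sub E (4 * k)"
proof -
  define R where "R = (\<lambda>p q. \<exists>v. pair_adj E p q v)"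
  \<comment> \<open>The choice is harmless: by \<open>pair_adj_unique\<close> the middle vertex is
    determined by \<open>p\<close> and \<open>q\<close>.\<close>
  define col where "col = (\<lambda>p q. SOME v. pair_adj E p q v)"
  define L where "L = {\<lambda>p q. fst q, \<lambda>p q. snd q, col}"
  let ?S = "V \<times> V"
  have col: "pair_adj E p q (col p q)" if "R p q" for p q
    using that unfolding R_def col_def by (rule someI_ex)
  have RS: "p \<in> ?S \<and> q \<in> ?S" if "R p q" for p q
    using that pair_adj_in_square[OF assms(2)] unfolding R_def by blast
  have proper: "q = q'" if "\<phi> \<in> L" "R p q" "R p q'" "\<phi> p q = \<phi> p q'" for \<phi> p q q'
    using that pair_adj_unique[OF E col[OF that(2)] col[OF that(3)]] by (auto simp: L_def)
  have "card L \<le> 3" unfolding L_def by (intro card_insert_le_m1) auto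
  \<comment> \<open>The factor 6 is the walk length \<open>2k\<close> times at most three
    labellings.\<close>
  then have L3: "real (2 * k * card L) \<le> 6 * real k"
    using mult_left_mono[of "real (card L)" 3 "2 * real k"] by simp
  have sum_card: "\<delta> * card ?S = (\<Sum>p\<in>?S. real (card {q. R p q}))"
  proof -
    have "{(p, q). \<exists>v. pair_adj E p q v} = (SIGMA p:?S. {q. R p q})"
    proof (intro set_eqI iffI)
      fix z assume "z \<in> {(p, q). \<exists>v. pair_adj E p q v}"
      then have "R (fst z) (snd z)" by (simp add: R_def case_prod_unfold)
      with RS show "z \<in> (SIGMA p:?S. {q. R p q})" by (cases z) auto
    qed (auto simp: R_def)
    moreover have "{q. R p q} \<subseteq> ?S" for p using RS by blast
    then have "finite {q. R p q}" for p
      using assms(1) by (meson finite_SigmaI finite_subset)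
    ultimately have "card {(p, q). \<exists>v. pair_adj E p q v} = (\<Sum>p\<in>?S. card {q. R p q})"
      using assms(1) by (simp add: card_SigmaI)
    then show ?thesis using \<delta> by (simp add: card_cartesian_product power2_eq_square)
  qed
  have "(4 * real (2 * k * card L) ^ 4) ^ k * card ?S \<le> (4 * (6 * real k) ^ 4) ^ k * card ?S"
    by (intro mult_right_mono power_mono mult_left_mono L3) auto
  then have dense': "(4 * real (2 * k * card L) ^ 4) ^ k * card ?S < \<delta> ^ k"
    using dense by (simp add: card_cartesian_product power2_eq_square)
  obtain f where f: "f 0 = f (2 * k)" "\<And>i. i < 2 * k \<Longrightarrow> R (f i) (f (Suc i))"
    and ne: "\<And>i j \<phi> \<psi>. i < j \<Longrightarrow> j < 2 * k \<Longrightarrow> \<phi> \<in> L \<Longrightarrow> \<psi> \<in> L \<Longrightarrow>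
      \<phi> (f i) (f (Suc i)) \<noteq> \<psi> (f j) (f (Suc j))"
  proof (rule conflict_free_closed_walk[of ?S R L k \<delta>])
    show "R q p" if "R p q" for p q using that unfolding R_def by (metis pair_adj_sym)
  qed (use assms RS proper sum_card dense' in \<open>auto simp: L_def\<close>)
  have "has_two_regular_sub E (2 * (2 * k))"
  proof (rule two_regular_of_pair_walk[OF E _ f(1), of "\<lambda>i. col (f i) (f (Suc i))"])
    show "2 \<le> 2 * k" using assms(6) by simp
    show "pair_adj E (f i) (f (Suc i)) (col (f i) (f (Suc i)))" if "i < 2 * k" for i
      using col f(2) that by blast
    show "{fst (f (Suc i)), snd (f (Suc i)), col (f i) (f (Suc i))} \<inter>
        {fst (f (Suc j)), snd (f (Suc j)), col (f j) (f (Suc j))} = {}"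
      if "i < j" "j < 2 * k" for i j
    proof -
      have "\<forall>\<phi>\<in>L. \<forall>\<psi>\<in>L. \<phi> (f i) (f (Suc i)) \<noteq> \<psi> (f j) (f (Suc j))"
        using ne[OF that] by blast
      then show ?thesis unfolding L_def by auto
    qed
  qed
  then show ?thesis by simp
qed

text \<open>Every vertex with an ordered pair of distinct edges through it yields its own adjacency,
  so the number of adjacencies is at least the sum of \<open>d * (d - 1)\<close> over the vertex
  degrees \<open>d\<close>. The degrees sum to three times the number of edges, and Cauchy-Schwarz
  finishes.\<close>

lemma card_pair_adj_ge:
  fixes E :: "'a set set"
  assumes "finite V" "E \<subseteq> Pow V" and E: "uniform 3 E" "linear_hypergraph E"
  shows "(3 * real (card E))\<^sup>2 \<le>
    card V * (real (card {(p, q). \<exists>v. pair_adj E p q v}) + 3 * real (card E))"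
proof -
  define N where "N = (\<lambda>v. {e \<in> E. v \<in> e})"
  define X where "X = (SIGMA v:V. {(e, e'). e \<in> N v \<and> e' \<in> N v \<and> e \<noteq> e'})"
  let ?T = "{(p, q). \<exists>v. pair_adj E p q v}"
  have finE: "finite E" using assms(1,2) finite_subset by auto
  then have finN: "finite (N v)" for v by (simp add: N_def)
  have sumN: "(\<Sum>v\<in>V. card (N v)) = 3 * card E"
  proof -
    have "(\<Sum>v\<in>V. card (N v)) = (\<Sum>v\<in>V. \<Sum>e\<in>E. if v \<in> e then 1 else 0)"
      using finE by (simp add: N_def sum.If_cases Int_def)
    also have "\<dots> = (\<Sum>e\<in>E. \<Sum>v\<in>V. if v \<in> e then 1 else 0)" by (rule sum.swap)
    also have "\<dots> = (\<Sum>e\<in>E. 3)"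
    proof (rule sum.cong[OF refl])
      fix e assume e: "e \<in> E"
      then have "V \<inter> {v. v \<in> e} = e" using assms(2) by auto
      then show "(\<Sum>v\<in>V. if v \<in> e then 1 else 0) = (3::nat)"
        using e assms(1) E(1) by (simp add: sum.If_cases uniform_def)
    qed
    finally show ?thesis by simp
  qed
  have "\<exists>t. e = {v, fst t, snd t}" if "e \<in> N v" for e v
  proof -
    have "card e = 3" "v \<in> e" using that E(1) by (auto simp: N_def uniform_def)
    then have "card (e - {v}) = 2" by simp
    then obtain x y where "e - {v} = {x, y}" by (auto simp: card_2_iff)
    then have "e = {v, fst (x, y), snd (x, y)}" using \<open>v \<in> e\<close> by auto
    then show ?thesis by blast
  qed
  \<comment> \<open>One fixed ordering of the two other vertices of each edge through
    \<open>v\<close> suffices for a lower bound.\<close>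
  then obtain t where t: "\<And>e v. e \<in> N v \<Longrightarrow> e = {v, fst (t e v), snd (t e v)}" by metis
  define g where "g = (\<lambda>(v, e, e'). ((fst (t e v), fst (t e' v)), (snd (t e v), snd (t e' v))))"
  have adj: "pair_adj E (fst (g (v, e, e'))) (snd (g (v, e, e'))) v" if "(v, e, e') \<in> X" for v e e'
    using that t[of e v] t[of e' v] by (auto simp: X_def g_def pair_adj_def N_def)
  have "inj_on g X"
  proof (rule inj_onI)
    fix x y assume xy: "x \<in> X" "y \<in> X" "g x = g y"
    obtain v e e' w d d' where vw: "x = (v, e, e')" "y = (w, d, d')"
      by (cases x; cases y) auto
    with xy have X: "(v, e, e') \<in> X" "(w, d, d') \<in> X" and eq: "g (v, e, e') = g (w, d, d')"
      by auto
    \<comment> \<open>The middle vertex is recovered from the adjacency alone, and the coordinates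
      then recover both edges.\<close>
    have "v = w"
      using pair_adj_unique(2)[OF E adj[OF X(1)]] adj[OF X(2)] eq by metis
    moreover have "fst (t e v) = fst (t d w)" "snd (t e v) = snd (t d w)"
      "fst (t e' v) = fst (t d' w)" "snd (t e' v) = snd (t d' w)"
      using eq by (auto simp: g_def)
    ultimately show "x = y"
      using X t[of e v] t[of d w] t[of e' v] t[of d' w] by (simp add: X_def vw)
  qed
  moreover have "g ` X \<subseteq> ?T"
  proof
    fix z assume "z \<in> g ` X"
    then obtain v e e' where "(v, e, e') \<in> X" "z = g (v, e, e')" by auto
    with adj[of v e e'] show "z \<in> ?T" by (auto simp: case_prod_unfold)
  qed
  moreover have "finite ?T"
  proof (rule finite_subset)
    show "?T \<subseteq> (V \<times> V) \<times> (V \<times> V)"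
      using pair_adj_in_square[OF assms(2)] by blast
  qed (use assms(1) in auto)
  ultimately have XT: "card X \<le> card ?T" by (metis card_image card_mono)
  have "card X = (\<Sum>v\<in>V. card {(e, e'). e \<in> N v \<and> e' \<in> N v \<and> e \<noteq> e'})"
    unfolding X_def
    using assms(1) finN
    by (intro card_SigmaI) (auto intro: finite_subset[of _ "N v \<times> N v" for v])
  moreover have "card {(e, e'). e \<in> N v \<and> e' \<in> N v \<and> e \<noteq> e'} + card (N v) = (card (N v))\<^sup>2" for v
  proof -
    let ?D = "(\<lambda>e. (e, e)) ` N v"
    have "card {(e, e'). e \<in> N v \<and> e' \<in> N v \<and> e \<noteq> e'} + card ?D =
        card ({(e, e'). e \<in> N v \<and> e' \<in> N v \<and> e \<noteq> e'} \<union> ?D)"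
      using finN by (intro card_Un_disjoint[symmetric])
        (auto intro: finite_subset[of _ "N v \<times> N v"])
    also have "{(e, e'). e \<in> N v \<and> e' \<in> N v \<and> e \<noteq> e'} \<union> ?D = N v \<times> N v" by auto
    finally show ?thesis
      by (simp add: card_image inj_on_def card_cartesian_product power2_eq_square)
  qed
  ultimately have "card X + 3 * card E = (\<Sum>v\<in>V. (card (N v))\<^sup>2)"
    by (simp flip: sumN sum.distrib)
  from arg_cong[OF this, of real]
  have sq: "(\<Sum>v\<in>V. (real (card (N v)))\<^sup>2) = real (card X) + 3 * real (card E)"
    by simp
  have "(\<Sum>v\<in>V. 1 * real (card (N v)))\<^sup>2 \<le> (\<Sum>v\<in>V. 1\<^sup>2) * (\<Sum>v\<in>V. (real (card (N v)))\<^sup>2)"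
    by (rule Cauchy_Schwarz_ineq_sum)
  moreover have "(\<Sum>v\<in>V. 1 * real (card (N v))) = 3 * real (card E)"
    using sumN by (simp flip: of_nat_sum)
  ultimately have "(3 * real (card E))\<^sup>2 \<le> card V * (real (card X) + 3 * real (card E))"
    by (simp add: sq)
  also have "\<dots> \<le> card V * (real (card ?T) + 3 * real (card E))"
    using XT by (intro mult_left_mono) auto
  finally show ?thesis .
qed

section \<open>From the average degree to the exponent\<close>

theorem theorem1p2:
  fixes l :: nat
  assumes "l \<ge> 2"
  shows "\<exists>c::real. \<forall>n::nat. real (f_ext n (4 * l)) \<le> c * real n powr (3 / 2 + 1 / real l)"
proof -
  \<comment> \<open>The base of the density threshold in
    \<open>has_two_regular_sub_of_dense_pairs\<close> for \<open>k = l\<close>.\<close>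
  define B :: real where "B = 4 * (6 * real l) ^ 4"
  have B: "B \<ge> 1"
  proof -
    have "(1::real) ^ 4 \<le> (6 * real l) ^ 4" using assms by (intro power_mono) auto
    then show ?thesis by (simp add: B_def)
  qed
  have "real (f_ext n (4 * l)) \<le> sqrt B * real n powr (3 / 2 + 1 / real l)" for n
  proof -
    let ?V = "{..<n}"
    obtain E where adm: "admissible ?V (4 * l) E" and m: "card E = f_ext n (4 * l)"
      using f_ext_attained by blast
    then have sub: "E \<subseteq> Pow ?V" and E: "uniform 3 E" "linear_hypergraph E"
      and no: "\<not> has_two_regular_sub E (4 * l)"
      by (auto simp: admissible_def hypergraph_def)
    define T where "T = real (card {(p, q). \<exists>v. pair_adj E p q v})"
    define M where "M = real (card E)"
    define \<delta> where "\<delta> = T / (real n)\<^sup>2"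
    have count: "(3 * M)\<^sup>2 \<le> n * (T + 3 * M)"
      using card_pair_adj_ge[OF _ sub E] by (simp add: M_def T_def)
    show ?thesis
    \<comment> \<open>With at most \<open>n\<close> edges the bound is trivial as the exponent
      exceeds 1. For \<open>n = 0\<close> the count forces \<open>M = 0\<close>, and
      \<open>0 powr\<close> is 0.\<close>
    proof (cases "n = 0 \<or> M \<le> n")
      case True
      have "M \<le> n"
        using True count by (auto simp: M_def)
      also have "real n \<le> 1 * real n powr (3 / 2 + 1 / real l)"
      proof -
        have "1 \<le> 3 / 2 + 1 / real l" by (simp add: add_increasing2)
        then show ?thesis
          using powr_mono[of 1 "3 / 2 + 1 / real l" "real n"] by (cases "n = 0") auto
      qed
      also have "\<dots> \<le> sqrt B * real n powr (3 / 2 + 1 / real l)"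
        using B by (intro mult_right_mono) auto
      finally show ?thesis by (simp add: M_def m)
    next
      case False
      then have n: "real n \<ge> 1" and Mn: "M > n" by auto
      have "n * M \<le> M * M" using Mn n by (intro mult_right_mono) auto
      \<comment> \<open>Since \<open>M > n\<close>, the linear term \<open>3 * n * M\<close> is
        absorbed into \<open>9 * M * M\<close>.\<close>
      then have MT: "M\<^sup>2 \<le> n * T"
      proof -
        have "9 * M\<^sup>2 \<le> n * T + 3 * (n * M)"
          using count by (simp add: power2_eq_square algebra_simps)
        with \<open>n * M \<le> M * M\<close> zero_le_power2[of M] show ?thesis
          by (simp only: power2_eq_square)
      qed
      have "M\<^sup>2 > 0" using Mn n by simp
      with MT have "0 < n * T" by linarith
      then have "\<delta> > 0" using n by (simp add: \<delta>_def zero_less_mult_iff)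
      have \<delta>_card: "\<delta> * (card ?V)\<^sup>2 = card {(p, q). \<exists>v. pair_adj E p q v}"
        using n by (simp add: \<delta>_def T_def)
      have "\<not> B ^ l * (card ?V)\<^sup>2 < \<delta> ^ l"
        using has_two_regular_sub_of_dense_pairs[OF _ sub _ E _ \<open>\<delta> > 0\<close> \<delta>_card, of l]
          no assms n by (auto simp: B_def lessThan_empty_iff)
      then have "\<delta> ^ l \<le> B ^ l * (real n)\<^sup>2" by simp
      \<comment> \<open>Writing the number of pairs as an \<open>l\<close>-th power allows the
        \<open>l\<close>-th root to be taken. This is the source of \<open>2 / l\<close>, which the
        final square root halves.\<close>
      also have "(real n)\<^sup>2 = (real n powr (2 / l)) ^ l"
        using assms n by (simp add: powr_power)
      finally have "\<delta> ^ l \<le> (B * real n powr (2 / l)) ^ l"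
        by (simp add: power_mult_distrib)
      then have "\<delta> \<le> B * real n powr (2 / l)"
        using B \<open>\<delta> > 0\<close> assms by (subst (asm) power_mono_iff) auto
      then have "(real n)\<^sup>2 * \<delta> \<le> (real n)\<^sup>2 * (B * real n powr (2 / l))"
        by (intro mult_left_mono) auto
      then have T_le: "T \<le> (real n)\<^sup>2 * (B * real n powr (2 / l))"
        using n by (simp add: \<delta>_def)
      have "M\<^sup>2 \<le> n * ((real n)\<^sup>2 * (B * real n powr (2 / l)))"
        using MT mult_left_mono[OF T_le, of "real n"] by simp
      also have "\<dots> = B * (real n powr 3 * real n powr (2 / l))"
        using n by (simp add: powr_numeral power2_eq_square power3_eq_cube)
      also have "\<dots> = (sqrt B * real n powr (3 / 2 + 1 / real l))\<^sup>2"
      proof -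
        have "(real n powr (3 / 2 + 1 / real l))\<^sup>2 = real n powr (3 + 2 / l)"
          using n by (simp add: powr_power algebra_simps)
        then show ?thesis using B by (simp add: power_mult_distrib powr_add)
      qed
      finally have "M \<le> sqrt B * real n powr (3 / 2 + 1 / real l)"
        by (rule power2_le_imp_le) (use B in auto)
      then show ?thesis by (simp add: M_def m)
    qed
  qed
  then show ?thesis by blast
qed

end
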